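(* Let $X$ be a complex manifold, let $E \to X$ be a holomorphic vector bundle with a smooth Hermitian form $b$ (possibly degenerate), and let $D$ be a Chern connection of $(E,b)$. Then the curvature tensor $$R(\alpha,\overline\beta,s,\overline t) = b\bigl(\tfrac{i}{2} D^2_{\alpha\overline\beta}\, s, \overline t\bigr),$$ where $\alpha,\beta$ are tangent fields of type $(1,0)$ and $s,t$ are sections of $E$, is independent of the choice of the Chern connection $D$.
   Context: A smooth Hermitian form $b$ on $E$ is a smoothly varying family of (possibly degenerate) Hermitian forms on the fibers; $b(s,\overline t)$ is linear in $s$ and conjugate linear in $t$. A Chern connection of $b$ is a connection $D$ on $E$ such that $d\,b(s,\overline t) = b(Ds,\overline t) + b(s,\overline{Dt})$ for all smooth sections $s,t$ of $E$ and whose $(0,1)$-part is $\bar\partial$. (When $b$ is degenerate such a connection need not be unique.) $D^2$ is the curvature form of $D$, a 2-form with values in $\mathrm{End}(E)$, and $D^2_{\alpha\overline\beta}$ is its value on $(\alpha,\overline\beta)$. *)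

theory Defs
  imports "HOL-Analysis.Analysis"
begin

section \<open>Smooth and holomorphic functions of several variables\<close>

text \<open>Both notions are meant for open sets \<open>S\<close>. Derivatives in \<open>Ck\<close> are over the reals, so
  \<open>Csmooth\<close> on \<open>complex ^ 'n\<close> is real smoothness; in finite dimension, continuity of all the
  directional derivatives \<open>\<lambda>x. f' x v\<close> is continuity of the derivative.\<close>

primrec Ck :: "nat \<Rightarrow> 'a::real_normed_vector set \<Rightarrow> ('a \<Rightarrow> 'b::real_normed_vector) \<Rightarrow> bool" where
  "Ck 0 S f \<longleftrightarrow> continuous_on S f"
| "Ck (Suc k) S f \<longleftrightarrow>
     (\<exists>f'. (\<forall>x\<in>S. (f has_derivative f' x) (at x)) \<and> (\<forall>v. Ck k S (\<lambda>x. f' x v)))"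

definition Csmooth :: "'a::real_normed_vector set \<Rightarrow> ('a \<Rightarrow> 'b::real_normed_vector) \<Rightarrow> bool" where
  "Csmooth S f \<longleftrightarrow> (\<forall>k. Ck k S f)"

definition mholomorphic_on :: "(complex ^ 'n) set \<Rightarrow> (complex ^ 'n \<Rightarrow> complex) \<Rightarrow> bool" where
  "mholomorphic_on S f \<longleftrightarrow>
     (\<forall>z\<in>S. \<exists>f'. (f has_derivative f') (at z) \<and> (\<forall>c v. f' (c *s v) = c * f' v))"


section \<open>Complex manifolds\<close>

type_synonym ('x, 'n) atlas = "('x set \<times> ('x \<Rightarrow> complex ^ 'n)) set"

definition complex_manifold ::
    "('x::{t2_space, second_countable_topology}, 'n::finite) atlas \<Rightarrow> bool" where
  "complex_manifold A \<longleftrightarrow>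
     (\<Union>(U, \<phi>)\<in>A. U) = UNIV \<and>
     (\<forall>(U, \<phi>)\<in>A. open U \<and> open (\<phi> ` U) \<and> homeomorphism U (\<phi> ` U) \<phi> (inv_into U \<phi>)) \<and>
     (\<forall>(U, \<phi>)\<in>A. \<forall>(V, \<psi>)\<in>A. \<forall>k.
        mholomorphic_on (\<phi> ` (U \<inter> V)) (\<lambda>z. \<psi> (inv_into U \<phi> z) $ k))"

definition smooth_fun_on ::
    "('x::topological_space, 'n::finite) atlas \<Rightarrow> 'x set \<Rightarrow> ('x \<Rightarrow> complex) \<Rightarrow> bool" where
  "smooth_fun_on A W f \<longleftrightarrow>
     (\<forall>(U, \<phi>)\<in>A. Csmooth (\<phi> ` (W \<inter> U)) (\<lambda>z. f (inv_into U \<phi> z)))"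

definition hol_fun_on ::
    "('x::topological_space, 'n::finite) atlas \<Rightarrow> 'x set \<Rightarrow> ('x \<Rightarrow> complex) \<Rightarrow> bool" where
  "hol_fun_on A W f \<longleftrightarrow>
     (\<forall>(U, \<phi>)\<in>A. mholomorphic_on (\<phi> ` (W \<inter> U)) (\<lambda>z. f (inv_into U \<phi> z)))"

definition smooth_near ::
    "('x::topological_space, 'n::finite) atlas \<Rightarrow> 'x \<Rightarrow> ('x \<Rightarrow> complex) \<Rightarrow> bool" where
  "smooth_near A x f \<longleftrightarrow> (\<exists>W. open W \<and> x \<in> W \<and> smooth_fun_on A W f)"

definition hol_near ::
    "('x::topological_space, 'n::finite) atlas \<Rightarrow> 'x \<Rightarrow> ('x \<Rightarrow> complex) \<Rightarrow> bool" where
  "hol_near A x f \<longleftrightarrow> (\<exists>W. open W \<and> x \<in> W \<and> hol_fun_on A W f)"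


section \<open>Complexified tangent vectors and vector fields\<close>

text \<open>An element of the complexified tangent space at \<open>x\<close> is a complex-linear derivation of the
  algebra of germs at \<open>x\<close> of smooth complex-valued functions. A germ is given by any
  representative; derivations are required to vanish on functions that are not smooth near \<open>x\<close>,
  so that each tangent vector is a unique HOL function. The differential of \<open>f\<close> at \<open>\<xi>\<close> is \<open>\<xi> f\<close>.\<close>

type_synonym 'x tvec = "('x \<Rightarrow> complex) \<Rightarrow> complex"
type_synonym 'x vfield = "'x \<Rightarrow> 'x tvec"

definition tangent ::
    "('x::topological_space, 'n::finite) atlas \<Rightarrow> 'x \<Rightarrow> 'x tvec set" where
  "tangent A x = {\<xi>.
     (\<forall>f g. smooth_near A x f \<and> smooth_near A x g \<longrightarrow> \<xi> (\<lambda>y. f y + g y) = \<xi> f + \<xi> g) \<and>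
     (\<forall>c f. smooth_near A x f \<longrightarrow> \<xi> (\<lambda>y. c * f y) = c * \<xi> f) \<and>
     (\<forall>f g. smooth_near A x f \<and> smooth_near A x g \<longrightarrow>
        \<xi> (\<lambda>y. f y * g y) = \<xi> f * g x + f x * \<xi> g) \<and>
     (\<forall>f g. smooth_near A x f \<and> eventually (\<lambda>y. f y = g y) (nhds x) \<longrightarrow> \<xi> f = \<xi> g) \<and>
     (\<forall>f. \<not> smooth_near A x f \<longrightarrow> \<xi> f = 0)}"

definition cnj_tvec :: "'x tvec \<Rightarrow> 'x tvec" where
  "cnj_tvec \<xi> = (\<lambda>f. cnj (\<xi> (\<lambda>y. cnj (f y))))"

definition cnj_field :: "'x vfield \<Rightarrow> 'x vfield" where
  "cnj_field V = (\<lambda>x. cnj_tvec (V x))"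

text \<open>Type \<open>(1,0)\<close>, the span of the \<open>\<partial>/\<partial>z\<^sub>j\<close>: vectors annihilating antiholomorphic germs.
  Type \<open>(0,1)\<close>: vectors annihilating holomorphic germs.\<close>

definition tangent10 ::
    "('x::topological_space, 'n::finite) atlas \<Rightarrow> 'x \<Rightarrow> 'x tvec set" where
  "tangent10 A x = {\<xi> \<in> tangent A x. \<forall>f. hol_near A x f \<longrightarrow> \<xi> (\<lambda>y. cnj (f y)) = 0}"

definition tangent01 ::
    "('x::topological_space, 'n::finite) atlas \<Rightarrow> 'x \<Rightarrow> 'x tvec set" where
  "tangent01 A x = {\<xi> \<in> tangent A x. \<forall>f. hol_near A x f \<longrightarrow> \<xi> f = 0}"

definition smooth_field ::
    "('x::topological_space, 'n::finite) atlas \<Rightarrow> 'x vfield \<Rightarrow> bool" where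
  "smooth_field A V \<longleftrightarrow>
     (\<forall>x. V x \<in> tangent A x) \<and>
     (\<forall>W f. open W \<and> smooth_fun_on A W f \<longrightarrow> smooth_fun_on A W (\<lambda>x. V x f))"

definition smooth_field10 ::
    "('x::topological_space, 'n::finite) atlas \<Rightarrow> 'x vfield \<Rightarrow> bool" where
  "smooth_field10 A V \<longleftrightarrow> smooth_field A V \<and> (\<forall>x. V x \<in> tangent10 A x)"

definition lie_bracket ::
    "('x::topological_space, 'n::finite) atlas \<Rightarrow> 'x vfield \<Rightarrow> 'x vfield \<Rightarrow> 'x vfield" where
  "lie_bracket A V W = (\<lambda>x f.
     if smooth_near A x f then V x (\<lambda>y. W y f) - W x (\<lambda>y. V y f) else 0)"


section \<open>Holomorphic vector bundles\<close>

text \<open>A bundle over the type \<open>'x\<close> is a family of complex vector spaces \<open>fibre B x\<close>, together with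
  a set of local holomorphic frames \<open>(U, r, e)\<close>, i.e. of local trivialisations
  \<open>(x, c) \<mapsto> \<Sum>j<r. c j \<cdot> e j x\<close> over the open set \<open>U\<close>; the transition matrices are holomorphic.
  Only for the sake of a common notation for the vector space operations, all the fibres live in
  one complex vector space \<open>'v\<close> with scalar multiplication \<open>smul B\<close> (any family of vector spaces
  embeds into its direct sum). There is no topology on \<open>'v\<close>, and the positions of
  the fibres relative to one another carry no information: the total space is the disjoint union
  \<open>SIGMA x:UNIV. fibre B x\<close>, with the complex structure given by the trivialisations.\<close>

record ('x, 'v) vbundle =
  smul :: "complex \<Rightarrow> 'v \<Rightarrow> 'v"
  fibre :: "'x \<Rightarrow> 'v set"
  frames :: "('x set \<times> nat \<times> (nat \<Rightarrow> 'x \<Rightarrow> 'v)) set"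

definition is_basis_of ::
    "(complex \<Rightarrow> 'v::ab_group_add \<Rightarrow> 'v) \<Rightarrow> nat \<Rightarrow> (nat \<Rightarrow> 'v) \<Rightarrow> 'v set \<Rightarrow> bool" where
  "is_basis_of sc r w F \<longleftrightarrow>
     inj_on w {..<r} \<and> \<not> module.dependent sc (w ` {..<r}) \<and> module.span sc (w ` {..<r}) = F"

definition holomorphic_vector_bundle ::
    "('x::{t2_space, second_countable_topology}, 'n::finite) atlas
      \<Rightarrow> ('x, 'v::ab_group_add) vbundle \<Rightarrow> bool" where
  "holomorphic_vector_bundle A B \<longleftrightarrow>
     vector_space (smul B) \<and>
     (\<forall>x. module.subspace (smul B) (fibre B x)) \<and>
     (\<Union>(U, r, e)\<in>frames B. U) = UNIV \<and>
     (\<forall>(U, r, e)\<in>frames B. open U \<and>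
        (\<forall>x\<in>U. is_basis_of (smul B) r (\<lambda>j. e j x) (fibre B x))) \<and>
     (\<forall>(U, r, e)\<in>frames B. \<forall>(V, q, d)\<in>frames B. \<exists>g.
        (\<forall>i<r. \<forall>j<q. hol_fun_on A (U \<inter> V) (g i j)) \<and>
        (\<forall>x\<in>U \<inter> V. \<forall>j<q. d j x = (\<Sum>i<r. smul B (g i j x) (e i x))))"

definition smooth_section ::
    "('x::topological_space, 'n::finite) atlas \<Rightarrow> ('x, 'v::ab_group_add) vbundle
      \<Rightarrow> ('x \<Rightarrow> 'v) \<Rightarrow> bool" where
  "smooth_section A B s \<longleftrightarrow>
     (\<forall>x. s x \<in> fibre B x) \<and>
     (\<forall>(U, r, e)\<in>frames B. \<exists>f. (\<forall>j<r. smooth_fun_on A U (f j)) \<and>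
        (\<forall>x\<in>U. s x = (\<Sum>j<r. smul B (f j x) (e j x))))"

text \<open>\<open>b x v w\<close> is the form at the point \<open>x\<close>: linear in \<open>v\<close>, hence (being Hermitian) conjugate-linear in \<open>w\<close>.\<close>

definition smooth_hermitian_form ::
    "('x::topological_space, 'n::finite) atlas \<Rightarrow> ('x, 'v::ab_group_add) vbundle
      \<Rightarrow> ('x \<Rightarrow> 'v \<Rightarrow> 'v \<Rightarrow> complex) \<Rightarrow> bool" where
  "smooth_hermitian_form A B b \<longleftrightarrow>
     (\<forall>x. \<forall>u\<in>fibre B x. \<forall>v\<in>fibre B x. \<forall>w\<in>fibre B x. \<forall>c.
        b x (u + v) w = b x u w + b x v w \<and>
        b x (smul B c v) w = c * b x v w \<and>
        b x w v = cnj (b x v w)) \<and>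
     (\<forall>(U, r, e)\<in>frames B. \<forall>i<r. \<forall>j<r. smooth_fun_on A U (\<lambda>x. b x (e i x) (e j x)))"


section \<open>Connections\<close>

text \<open>A bundle-valued one-form is a family of complex-linear maps from the complexified tangent
  spaces to the fibres; its values outside the tangent spaces are irrelevant.\<close>

type_synonym ('x, 'v) vform1 = "'x \<Rightarrow> 'x tvec \<Rightarrow> 'v"

definition smooth_vform1 ::
    "('x::topological_space, 'n::finite) atlas \<Rightarrow> ('x, 'v::ab_group_add) vbundle
      \<Rightarrow> ('x, 'v) vform1 \<Rightarrow> bool" where
  "smooth_vform1 A B \<omega> \<longleftrightarrow>
     (\<forall>x. \<forall>\<xi>\<in>tangent A x. \<omega> x \<xi> \<in> fibre B x) \<and>
     (\<forall>x. \<forall>\<xi>\<in>tangent A x. \<forall>\<eta>\<in>tangent A x. \<omega> x (\<lambda>f. \<xi> f + \<eta> f) = \<omega> x \<xi> + \<omega> x \<eta>) \<and>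
     (\<forall>x. \<forall>\<xi>\<in>tangent A x. \<forall>c. \<omega> x (\<lambda>f. c * \<xi> f) = smul B c (\<omega> x \<xi>)) \<and>
     (\<forall>V. smooth_field A V \<longrightarrow> smooth_section A B (\<lambda>x. \<omega> x (V x)))"

text \<open>\<open>D s x \<xi>\<close> is the covariant derivative of the section \<open>s\<close> at \<open>x\<close> in the direction \<open>\<xi>\<close>.\<close>

definition is_connection ::
    "('x::topological_space, 'n::finite) atlas \<Rightarrow> ('x, 'v::ab_group_add) vbundle
      \<Rightarrow> (('x \<Rightarrow> 'v) \<Rightarrow> ('x, 'v) vform1) \<Rightarrow> bool" where
  "is_connection A B D \<longleftrightarrow>
     (\<forall>s. smooth_section A B s \<longrightarrow> smooth_vform1 A B (D s)) \<and>
     (\<forall>s t. smooth_section A B s \<and> smooth_section A B t \<longrightarrow>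
        (\<forall>x. \<forall>\<xi>\<in>tangent A x. D (\<lambda>y. s y + t y) x \<xi> = D s x \<xi> + D t x \<xi>)) \<and>
     (\<forall>f s. smooth_fun_on A UNIV f \<and> smooth_section A B s \<longrightarrow>
        (\<forall>x. \<forall>\<xi>\<in>tangent A x.
           D (\<lambda>y. smul B (f y) (s y)) x \<xi> = smul B (\<xi> f) (s x) + smul B (f x) (D s x \<xi>)))"

text \<open>The \<open>(0,1)\<close>-part of \<open>\<omega>\<close> is the Dolbeault derivative of \<open>s\<close>, written \<open>dbar s\<close>: if
  \<open>s = \<Sum>j. f j \<cdot> e j\<close> in a local holomorphic frame, then
  \<open>dbar s = \<Sum>j. dbar (f j) \<otimes> e j\<close>, and \<open>dbar (f j)\<close> has the value \<open>\<xi> (f j)\<close> at \<open>\<xi>\<close> of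
  type \<open>(0,1)\<close>.\<close>

definition has_01_part_dbar ::
    "('x::topological_space, 'n::finite) atlas \<Rightarrow> ('x, 'v::ab_group_add) vbundle
      \<Rightarrow> ('x, 'v) vform1 \<Rightarrow> ('x \<Rightarrow> 'v) \<Rightarrow> bool" where
  "has_01_part_dbar A B \<omega> s \<longleftrightarrow>
     (\<forall>(U, r, e)\<in>frames B. \<forall>f.
        (\<forall>j<r. smooth_fun_on A U (f j)) \<and>
        (\<forall>x\<in>U. s x = (\<Sum>j<r. smul B (f j x) (e j x))) \<longrightarrow>
        (\<forall>x\<in>U. \<forall>\<xi>\<in>tangent01 A x. \<omega> x \<xi> = (\<Sum>j<r. smul B (\<xi> (f j)) (e j x))))"

text \<open>The metric condition is an identity of complex-linear one-forms. Since \<open>b\<close> is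
  conjugate-linear in its second argument, the term with \<open>D t\<close> pairs \<open>s\<close> with the value of
  \<open>D t\<close> at the conjugate vector; for a real tangent vector the conjugation has no effect.\<close>

definition chern_connection ::
    "('x::topological_space, 'n::finite) atlas \<Rightarrow> ('x, 'v::ab_group_add) vbundle
      \<Rightarrow> ('x \<Rightarrow> 'v \<Rightarrow> 'v \<Rightarrow> complex) \<Rightarrow> (('x \<Rightarrow> 'v) \<Rightarrow> ('x, 'v) vform1) \<Rightarrow> bool" where
  "chern_connection A B b D \<longleftrightarrow>
     is_connection A B D \<and>
     (\<forall>s t. smooth_section A B s \<and> smooth_section A B t \<longrightarrow>
        (\<forall>x. \<forall>\<xi>\<in>tangent A x.
           \<xi> (\<lambda>y. b y (s y) (t y)) = b x (D s x \<xi>) (t x) + b x (s x) (D t x (cnj_tvec \<xi>)))) \<and>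
     (\<forall>s. smooth_section A B s \<longrightarrow> has_01_part_dbar A B (D s) s)"


section \<open>Curvature\<close>

text \<open>Extension of \<open>D\<close> to bundle-valued one-forms, given by \<open>D(\<eta> \<otimes> s) = d\<eta> \<otimes> s - \<eta> \<and> D s\<close>, as
  evaluated on a pair of vector fields. The convention is \<open>(\<eta> \<and> \<zeta>)(V, W) = \<eta>(V) \<zeta>(W) - \<eta>(W) \<zeta>(V)\<close>
  and \<open>d\<eta>(V, W) = V(\<eta>(W)) - W(\<eta>(V)) - \<eta>([V, W])\<close>, without a factor \<open>1/2\<close>.\<close>

definition ext_cov_deriv ::
    "('x::topological_space, 'n::finite) atlas \<Rightarrow> (('x \<Rightarrow> 'v::ab_group_add) \<Rightarrow> ('x, 'v) vform1)
      \<Rightarrow> ('x, 'v) vform1 \<Rightarrow> 'x vfield \<Rightarrow> 'x vfield \<Rightarrow> 'x \<Rightarrow> 'v" where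
  "ext_cov_deriv A D \<omega> V W = (\<lambda>x.
     D (\<lambda>y. \<omega> y (W y)) x (V x) - D (\<lambda>y. \<omega> y (V y)) x (W x) - \<omega> x (lie_bracket A V W x))"

definition curvature_form ::
    "('x::topological_space, 'n::finite) atlas \<Rightarrow> (('x \<Rightarrow> 'v::ab_group_add) \<Rightarrow> ('x, 'v) vform1)
      \<Rightarrow> 'x vfield \<Rightarrow> 'x vfield \<Rightarrow> ('x \<Rightarrow> 'v) \<Rightarrow> 'x \<Rightarrow> 'v" where
  "curvature_form A D V W s = ext_cov_deriv A D (D s) V W"

definition curvature_tensor ::
    "('x::topological_space, 'n::finite) atlas \<Rightarrow> ('x, 'v::ab_group_add) vbundle
      \<Rightarrow> ('x \<Rightarrow> 'v \<Rightarrow> 'v \<Rightarrow> complex) \<Rightarrow> (('x \<Rightarrow> 'v) \<Rightarrow> ('x, 'v) vform1)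
      \<Rightarrow> 'x vfield \<Rightarrow> 'x vfield \<Rightarrow> ('x \<Rightarrow> 'v) \<Rightarrow> ('x \<Rightarrow> 'v) \<Rightarrow> 'x \<Rightarrow> complex" where
  "curvature_tensor A B b D \<alpha> \<beta> s t = (\<lambda>x.
     b x (smul B (\<i> / 2) (curvature_form A D \<alpha> (cnj_field \<beta>) s x)) (t x))"

end

theory Submission
  imports Defs "HOL-Complex_Analysis.Cauchy_Integral_Formula"
begin

text \<open>The idea is that, although a degenerate form \<open>b\<close> may have several Chern connections \<open>D\<close>, it
  determines the pairing \<open>b (D\<^sub>\<xi> s, t)\<close> for all smooth sections \<open>s\<close>, \<open>t\<close> and all tangent vectors \<open>\<xi>\<close>
  (\<open>chern_connection_pairing_eq\<close>). For \<open>\<xi>\<close> of type \<open>(0,1)\<close> even \<open>D\<^sub>\<xi> s\<close> is determined, being the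
  Dolbeault derivative. For \<open>\<xi>\<close> of type \<open>(1,0)\<close> the metric condition reads
  \<open>b (D\<^sub>\<xi> s, t) = \<xi> (b (s, t)) - b (s, D\<^sub>\<zeta> t)\<close> with \<open>\<zeta>\<close> the conjugate of \<open>\<xi>\<close>, which is of type \<open>(0,1)\<close>.

  Let \<open>W\<close> be the conjugate field of \<open>\<beta>\<close>. The curvature pairs \<open>t\<close> with
  \<open>D\<^sub>\<alpha> (D\<^sub>W s) - D\<^sub>W (D\<^sub>\<alpha> s) - D\<^bsub>[\<alpha>, W]\<^esub> s\<close>. Since \<open>D\<^sub>W s\<close> is a smooth section independent of \<open>D\<close>, the
  first term is settled by the pairing property, and so is the third one. For the second one,
  the metric condition gives
  \<open>b (D\<^sub>W (D\<^sub>\<alpha> s), t) = W (b (D\<^sub>\<alpha> s, t)) - b (D\<^sub>\<alpha> s, D\<^sub>\<beta> t)\<close>,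
  where the function \<open>b (D\<^sub>\<alpha> s, t)\<close> is determined, and where \<open>D\<close> may be replaced in each of the two
  arguments of the last term in turn, the other argument being a fixed smooth section.

  The bracket \<open>[\<alpha>, W]\<close> has no type in general, so the pairing property is needed for all tangent
  vectors, and these have to be split into types (\<open>tangent_decompose\<close>). As tangent vectors are
  derivations of germs, this amounts to the fact that derivations are spanned by the coordinate
  derivatives, which rests on Hadamard's lemma (\<open>Hadamard\<close>). The quotients that occur there, and the
  coordinates themselves, are smooth in one chart; that they are smooth in every chart requires the
  smoothness of the coordinate changes, which are only assumed to be complex differentiable. It
  follows from Cauchy's integral formula on complex lines and differentiation under the integral
  sign (\<open>mholomorphic_imp_Ck\<close>).\<close>

section \<open>Calculus of functions of class C^k\<close>

lemma Ck_cong: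
  assumes "open S" "\<And>x. x \<in> S \<Longrightarrow> f x = g x" "Ck k S f"
  shows "Ck k S g"
proof (cases k)
  case 0
  then show ?thesis using assms continuous_on_cong[of S S f g] by simp
next
  case (Suc m)
  then obtain f' where f': "\<forall>x\<in>S. (f has_derivative f' x) (at x)" "\<forall>v. Ck m S (\<lambda>x. f' x v)"
    using assms by auto
  have "\<forall>x\<in>S. (g has_derivative f' x) (at x)"
    using f'(1) assms(1,2) has_derivative_transform_within_open by blast
  then show ?thesis using f'(2) Suc by auto
qed

lemma Ck_SucI:
  assumes "\<And>x. x \<in> S \<Longrightarrow> (f has_derivative f' x) (at x)" "\<And>v. Ck k S (\<lambda>x. f' x v)"
  shows "Ck (Suc k) S f"
  using assms by auto

lemma Ck_lower: "Ck (Suc k) S f \<Longrightarrow> Ck k S f"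
proof (induction k arbitrary: f)
  case 0
  then show ?case
    by (auto intro!: continuous_at_imp_continuous_on dest: has_derivative_continuous)
next
  case (Suc k)
  then obtain f' where "\<forall>x\<in>S. (f has_derivative f' x) (at x)" "\<forall>v. Ck (Suc k) S (\<lambda>x. f' x v)"
    by auto
  then show ?case using Suc.IH by (intro Ck_SucI) auto
qed

lemma Ck_subset: "Ck k S f \<Longrightarrow> T \<subseteq> S \<Longrightarrow> Ck k T f"
proof (induction k arbitrary: f)
  case 0
  then show ?case by (auto intro: continuous_on_subset)
next
  case (Suc k)
  obtain f' where "\<forall>x\<in>S. (f has_derivative f' x) (at x)" "\<forall>v. Ck k S (\<lambda>x. f' x v)"
    using Suc.prems(1) by auto
  then show ?case using Suc by (intro Ck_SucI) auto
qed

lemma Ck_const: "Ck k S (\<lambda>x. c)"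
proof (induction k arbitrary: c)
  case (Suc k)
  show ?case by (rule Ck_SucI[where f' = "\<lambda>x v. 0"]) (use Suc in auto)
qed simp

lemma Ck_linear: "bounded_linear L \<Longrightarrow> Ck k S L"
proof (cases k)
  case 0
  then show "bounded_linear L \<Longrightarrow> ?thesis" by (auto intro: linear_continuous_on)
next
  case (Suc m)
  then show "bounded_linear L \<Longrightarrow> ?thesis"
    by (auto intro!: Ck_SucI[where f' = "\<lambda>x. L"] bounded_linear_imp_has_derivative Ck_const)
qed

lemma Ck_add: "Ck k S f \<Longrightarrow> Ck k S g \<Longrightarrow> Ck k S (\<lambda>x. f x + g x)"
proof (induction k arbitrary: f g)
  case 0
  then show ?case by (auto intro: continuous_intros)
next
  case (Suc k)
  obtain f' where f': "\<forall>x\<in>S. (f has_derivative f' x) (at x)" "\<forall>v. Ck k S (\<lambda>x. f' x v)"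
    using Suc.prems(1) by auto
  obtain g' where g': "\<forall>x\<in>S. (g has_derivative g' x) (at x)" "\<forall>v. Ck k S (\<lambda>x. g' x v)"
    using Suc.prems(2) by auto
  show ?case
    by (rule Ck_SucI[where f' = "\<lambda>x v. f' x v + g' x v"])
      (use f' g' Suc.IH in \<open>auto intro: has_derivative_add\<close>)
qed

lemma Ck_sum: "(\<And>i. i \<in> I \<Longrightarrow> Ck k S (f i)) \<Longrightarrow> Ck k S (\<lambda>x. \<Sum>i\<in>I. f i x)"
  by (induction I rule: infinite_finite_induct) (auto intro: Ck_const Ck_add)

lemma Ck_bounded_linear: "bounded_linear L \<Longrightarrow> Ck k S f \<Longrightarrow> Ck k S (\<lambda>x. L (f x))"
proof (induction k arbitrary: f)
  case 0
  then show ?case by (auto intro: bounded_linear.continuous_on)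
next
  case (Suc k)
  obtain f' where f': "\<forall>x\<in>S. (f has_derivative f' x) (at x)" "\<forall>v. Ck k S (\<lambda>x. f' x v)"
    using Suc.prems(2) by auto
  show ?case
    by (rule Ck_SucI[where f' = "\<lambda>x v. L (f' x v)"])
      (use f' Suc in \<open>auto intro: bounded_linear.has_derivative\<close>)
qed

lemma Ck_bounded_bilinear:
  assumes "bounded_bilinear pr"
  shows "Ck k S f \<Longrightarrow> Ck k S g \<Longrightarrow> Ck k S (\<lambda>x. pr (f x) (g x))"
proof (induction k arbitrary: f g)
  case 0
  then show ?case by (auto intro: bounded_bilinear.continuous_on[OF assms])
next
  case (Suc k)
  obtain f' where f': "\<forall>x\<in>S. (f has_derivative f' x) (at x)" "\<forall>v. Ck k S (\<lambda>x. f' x v)"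
    using Suc.prems(1) by auto
  obtain g' where g': "\<forall>x\<in>S. (g has_derivative g' x) (at x)" "\<forall>v. Ck k S (\<lambda>x. g' x v)"
    using Suc.prems(2) by auto
  show ?case
    by (rule Ck_SucI[where f' = "\<lambda>x v. pr (f x) (g' x v) + pr (f' x v) (g x)"])
      (use f' g' Suc.IH Suc.prems[THEN Ck_lower] in
        \<open>auto intro!: bounded_bilinear.FDERIV[OF assms] Ck_add simp del: Ck.simps\<close>)
qed

text \<open>The inner map takes values in a Euclidean space so that the derivative of \<open>f\<close> at the direction
  \<open>g' x v\<close>, which varies with \<open>x\<close>, can be expanded over the finitely many fixed directions in \<open>Basis\<close>,
  to which the hypothesis on \<open>f\<close> speaks.\<close>

lemma Ck_compose:
  fixes g :: "'a::real_normed_vector \<Rightarrow> 'b::euclidean_space"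
  assumes "g ` S \<subseteq> T"
  shows "Ck k T f \<Longrightarrow> Ck k S g \<Longrightarrow> Ck k S (\<lambda>x. f (g x))"
proof (induction k arbitrary: f)
  case 0
  then show ?case using assms by (auto intro: continuous_on_compose2)
next
  case (Suc k)
  obtain f' where f': "\<forall>x\<in>T. (f has_derivative f' x) (at x)" "\<forall>v. Ck k T (\<lambda>x. f' x v)"
    using Suc.prems(1) by auto
  obtain g' where g': "\<forall>x\<in>S. (g has_derivative g' x) (at x)" "\<forall>v. Ck k S (\<lambda>x. g' x v)"
    using Suc.prems(2) by auto
  show ?case
  proof (rule Ck_SucI[where f' = "\<lambda>x v. \<Sum>i\<in>Basis. (g' x v \<bullet> i) *\<^sub>R f' (g x) i"])
    fix x assume x: "x \<in> S"
    have lin: "linear (f' (g x))"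
      using f'(1) assms x by (meson has_derivative_linear image_subset_iff)
    have "(\<Sum>i\<in>Basis. (g' x v \<bullet> i) *\<^sub>R f' (g x) i) = f' (g x) (g' x v)" for v
    proof -
      have "f' (g x) (g' x v) = f' (g x) (\<Sum>i\<in>Basis. (g' x v \<bullet> i) *\<^sub>R i)"
        by (simp add: euclidean_representation)
      then show ?thesis
        by (simp add: linear_sum[OF lin] linear_cmul[OF lin])
    qed
    then show "((\<lambda>x. f (g x)) has_derivative (\<lambda>v. \<Sum>i\<in>Basis. (g' x v \<bullet> i) *\<^sub>R f' (g x) i)) (at x)"
      using has_derivative_compose[of g "g' x" x UNIV f "f' (g x)"] f'(1) g'(1) assms x by auto
  next
    fix v
    have "Ck k S (\<lambda>x. f' (g x) i)" for i
      by (rule Suc.IH) (use f'(2) Suc.prems Ck_lower in blast)+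
    then show "Ck k S (\<lambda>x. \<Sum>i\<in>Basis. (g' x v \<bullet> i) *\<^sub>R f' (g x) i)"
      by (intro Ck_sum Ck_bounded_bilinear[OF bounded_bilinear_scaleR]
          Ck_bounded_linear[OF bounded_linear_inner_left] g'(2)[rule_format])
  qed
qed

section \<open>Integrals depending on a parameter\<close>

lemma continuous_on_section:
  assumes "continuous_on (U \<times> T) (\<lambda>(x, t). F x t)" "x \<in> U"
  shows "continuous_on T (F x)"
  using continuous_on_compose2[OF assms(1) continuous_on_Pair[OF continuous_on_const continuous_on_id],
    of x T] assms(2) by auto

text \<open>The rule \<open>leibniz_rule\<close> asks for a derivative that is continuous in the operator norm;
  in finite dimension, continuity in each direction is enough, because an operator is determined by
  its values on \<open>Basis\<close>.\<close>

lemma has_derivative_parametric_integral: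
  fixes F :: "'a::euclidean_space \<Rightarrow> real \<Rightarrow> 'b::banach"
  assumes U: "open U" "convex U"
    and F': "\<And>x t. x \<in> U \<Longrightarrow> t \<in> {a..b} \<Longrightarrow> ((\<lambda>x. F x t) has_derivative F' x t) (at x)"
    and F: "\<And>x. x \<in> U \<Longrightarrow> continuous_on {a..b} (F x)"
    and cont: "\<And>v. continuous_on (U \<times> {a..b}) (\<lambda>(x, t). F' x t v)"
    and x: "x \<in> U"
  shows "((\<lambda>x. integral {a..b} (F x)) has_derivative (\<lambda>v. integral {a..b} (\<lambda>t. F' x t v))) (at x)"
proof -
  define G where "G x t = Blinfun (F' x t)" for x t
  have G: "blinfun_apply (G x t) = F' x t" if "x \<in> U" "t \<in> {a..b}" for x t
    unfolding G_def using F'[OF that] by (intro bounded_linear_Blinfun_apply has_derivative_bounded_linear)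
  have contG: "continuous_on (U \<times> cbox a b) (\<lambda>(x, t). G x t)"
    unfolding split_def
  proof (rule continuous_on_blinfun_componentwise)
    fix i :: 'a
    show "continuous_on (U \<times> cbox a b) (\<lambda>p. blinfun_apply (G (fst p) (snd p)) i)"
      by (rule continuous_on_eq[of _ "\<lambda>(x, t). F' x t i"]) (use cont[of i] in \<open>auto simp: G\<close>)
  qed
  have "((\<lambda>x. integral (cbox a b) (F x)) has_derivative integral (cbox a b) (G x)) (at x within U)"
    by (rule leibniz_rule[OF _ _ contG x U(2)])
      (use F' G F in \<open>auto intro: has_derivative_at_withinI integrable_continuous_interval\<close>)
  moreover
  have "blinfun_apply (integral (cbox a b) (G x)) v = integral {a..b} (\<lambda>t. F' x t v)" for v
  proof -
    have "continuous_on (cbox a b) (G x)"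
      using continuous_on_section[OF contG x] .
    then have "G x integrable_on cbox a b" by (rule integrable_continuous)
    from integral_linear[OF this blinfun.bounded_linear_left[of v]]
    have "blinfun_apply (integral (cbox a b) (G x)) v = integral {a..b} (\<lambda>t. G x t v)"
      by (simp add: o_def)
    also have "\<dots> = integral {a..b} (\<lambda>t. F' x t v)"
      by (rule integral_cong) (simp add: G x)
    finally show ?thesis .
  qed
  then have "blinfun_apply (integral (cbox a b) (G x)) = (\<lambda>v. integral {a..b} (\<lambda>t. F' x t v))"
    by (rule ext)
  ultimately show ?thesis
    by (simp only: at_within_open[OF x U(1)] box_real)
qed

lemma continuous_on_parametric_integral:
  fixes F :: "'a::euclidean_space \<Rightarrow> real \<Rightarrow> 'b::banach"
  assumes "continuous_on (U \<times> {a..b}) (\<lambda>(x, t). F x t)"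
  shows "continuous_on U (\<lambda>x. integral {a..b} (F x))"
  using integral_continuous_on_param[of U a b F] assms by simp

section \<open>Holomorphic functions of several variables are smooth\<close>

lemma bounded_bilinear_vector_scalar_mult:
  "bounded_bilinear (\<lambda>(c::complex) (v::complex ^ 'n::finite). c *s v)"
  unfolding bilinear_conv_bounded_bilinear[symmetric] bilinear_def
  by (auto intro!: linearI simp: vec_eq_iff algebra_simps)

text \<open>Cauchy's formula for the first derivative at the centre of a circle. Along the circle
  \<open>u = r exp (2 \<pi> \<i> t)\<close> the differential \<open>du\<close> is \<open>2 \<pi> \<i> u dt\<close>, which cancels both the constant
  in front of the integral and one of the two factors \<open>u\<close> in the denominator.\<close>

lemma Cauchy_mean_value_derivative:
  assumes "r > 0" "F holomorphic_on T" "open T" "cball 0 r \<subseteq> T"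
  shows "deriv F 0 = integral {0..1} (\<lambda>t. F (circlepath 0 r t) / circlepath 0 r t)"
proof -
  have "((\<lambda>u. F u / (u - 0) ^ Suc 1) has_contour_integral ((2 * pi * \<i>) / (fact 1) * (deriv ^^ 1) F 0))
           (circlepath 0 r)"
    using assms by (intro Cauchy_has_contour_integral_higher_derivative_circlepath)
      (auto intro: holomorphic_on_imp_continuous_on holomorphic_on_subset dest: ball_subset_cball[THEN subsetD])
  then have "((\<lambda>t. F (circlepath 0 r t) / (circlepath 0 r t)\<^sup>2
        * vector_derivative (circlepath 0 r) (at t within {0..1})) has_integral 2 * pi * \<i> * deriv F 0) {0..1}"
    by (simp add: has_contour_integral_def power2_eq_square)
  then have "((\<lambda>t. 2 * pi * \<i> * (F (circlepath 0 r t) / circlepath 0 r t))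
      has_integral 2 * pi * \<i> * deriv F 0) {0..1}"
    by (rule has_integral_eq[rotated])
      (use assms in \<open>simp add: vector_derivative_circlepath01 power2_eq_square,
        simp add: circlepath field_simps\<close>)
  then have "((\<lambda>t. (1 / (2 * pi * \<i>)) * (2 * pi * \<i> * (F (circlepath 0 r t) / circlepath 0 r t)))
      has_integral (1 / (2 * pi * \<i>)) * (2 * pi * \<i> * deriv F 0)) {0..1}"
    by (rule has_integral_mult_right)
  then have "((\<lambda>t. F (circlepath 0 r t) / circlepath 0 r t) has_integral deriv F 0) {0..1}"
    by simp
  then show ?thesis by (simp add: integral_unique)
qed

lemma mholomorphic_onD:
  assumes "mholomorphic_on S f" "z \<in> S" "(f has_derivative f') (at z)"
  shows "f' (c *s v) = c * f' v"
proof -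
  obtain g where "(f has_derivative g) (at z)" "\<forall>c v. g (c *s v) = c * g v"
    using assms(1,2) unfolding mholomorphic_on_def by blast
  then show ?thesis using has_derivative_unique[OF assms(3)] by blast
qed

text \<open>On a complex line, \<open>c \<mapsto> f (z + c *s v)\<close> is a holomorphic function of one variable with derivative
  \<open>f' z v\<close> at \<open>0\<close>, so Cauchy's formula writes \<open>f' z v\<close> as an integral of values of \<open>f\<close> over a circle.
  The radius of the circle can be kept fixed while \<open>z\<close> ranges over a neighbourhood \<open>U\<close>; this makes the
  formula usable for differentiation in \<open>z\<close>.\<close>

lemma mholomorphic_directional_derivative:
  fixes f :: "complex ^ 'n::finite \<Rightarrow> complex"
  assumes S: "open S" and f: "mholomorphic_on S f"
    and f': "\<And>z. z \<in> S \<Longrightarrow> (f has_derivative f' z) (at z)"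
    and z0: "z0 \<in> S"
  obtains U c where "open U" "convex U" "z0 \<in> U" "U \<subseteq> S" "continuous_on {0..1::real} c"
    "\<forall>t. c t \<noteq> 0" "\<forall>z\<in>U. \<forall>t\<in>{0..1}. z + c t *s v \<in> S"
    "\<forall>z\<in>U. f' z v = integral {0..1} (\<lambda>t. f (z + c t *s v) / c t)"
proof -
  interpret sm: bounded_bilinear "\<lambda>(c::complex) (v::complex ^ 'n). c *s v"
    by (rule bounded_bilinear_vector_scalar_mult)
  obtain \<rho> where \<rho>: "\<rho> > 0" "ball z0 (2 * \<rho>) \<subseteq> S"
  proof -
    obtain e where "e > 0" "ball z0 e \<subseteq> S" using S z0 open_contains_ball by blast
    then show ?thesis using that[of "e / 2"] by auto
  qed
  have "continuous (at 0) (\<lambda>c. c *s v)"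
    using sm.bounded_linear_left[of v] linear_continuous_at by blast
  then have "\<exists>d>0. \<forall>c. dist c 0 < d \<longrightarrow> dist (c *s v) (0 *s v) < \<rho>"
    using \<rho>(1) unfolding continuous_at_eps_delta by blast
  then obtain d where d: "d > 0" "\<And>c. norm c < d \<Longrightarrow> norm (c *s v) < \<rho>"
    by auto
  \<comment> \<open>Half of \<open>d\<close>, so that the closed disc of radius \<open>r\<close> lies in the open disc where the line stays in \<open>S\<close>.\<close>
  define r where "r = d / 2"
  have r: "r > 0" "r < d" using d by (auto simp: r_def)
  have inS: "z + c *s v \<in> S" if "z \<in> ball z0 \<rho>" "norm c < d" for z c
  proof -
    have "dist z0 (z + c *s v) \<le> dist z0 z + norm (c *s v)"
      by (metis add_diff_cancel_left' dist_norm dist_triangle norm_minus_commute)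
    then have "z + c *s v \<in> ball z0 (2 * \<rho>)" using that d(2)[of c] by auto
    then show ?thesis using \<rho> by blast
  qed
  show ?thesis
  proof (rule that[of "ball z0 \<rho>" "circlepath 0 r"])
    show "ball z0 \<rho> \<subseteq> S" using \<rho> by auto
    show "continuous_on {0..1} (circlepath 0 r)"
      using path_circlepath[of 0 r] by (simp add: path_def)
    show "\<forall>t. circlepath 0 r t \<noteq> 0" using r by (simp add: circlepath)
    show "\<forall>z\<in>ball z0 \<rho>. \<forall>t\<in>{0..1}. z + circlepath 0 r t *s v \<in> S"
      by (intro ballI inS) (use r in \<open>auto simp: circlepath norm_mult\<close>)
    show "\<forall>z\<in>ball z0 \<rho>. f' z v = integral {0..1} (\<lambda>t. f (z + circlepath 0 r t *s v) / circlepath 0 r t)"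
    proof
      fix z assume z: "z \<in> ball z0 \<rho>"
      define F where "F = (\<lambda>c. f (z + c *s v))"
      have F: "(F has_field_derivative f' (z + c *s v) v) (at c)" if "norm c < d" for c
      proof -
        have "((\<lambda>c. z + c *s v) has_derivative (\<lambda>h. h *s v)) (at c)"
          using sm.bounded_linear_left[of v, THEN bounded_linear_imp_has_derivative]
            has_derivative_add[OF has_derivative_const] by fastforce
        from has_derivative_compose[OF this f'[OF inS[OF z that]]]
        have "(F has_derivative (\<lambda>h. f' (z + c *s v) (h *s v))) (at c)"
          by (simp add: F_def)
        then show ?thesis
          using mholomorphic_onD[OF f inS[OF z that] f'[OF inS[OF z that]]]
          by (simp add: has_field_derivative_def mult_commute_abs)
      qed
      have "F holomorphic_on ball 0 d"
        using F unfolding holomorphic_on_open[OF open_ball] by fastforce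
      from Cauchy_mean_value_derivative[OF r(1) this]
      have "deriv F 0 = integral {0..1} (\<lambda>t. F (circlepath 0 r t) / circlepath 0 r t)"
        using r by (simp add: cball_subset_ball_iff)
      moreover have "deriv F 0 = f' z v"
        using F[of 0] d by (auto intro!: DERIV_imp_deriv)
      ultimately show "f' z v = integral {0..1} (\<lambda>t. f (z + circlepath 0 r t *s v) / circlepath 0 r t)"
        by (simp add: F_def)
    qed
  qed (use \<rho> in auto)
qed

text \<open>The integral formula is used twice: first it shows that the directional derivatives are
  continuous, because \<open>f\<close> is; then this continuity allows differentiating under the integral sign,
  and the resulting derivative is complex linear because the derivatives of \<open>f\<close> are.\<close>

lemma mholomorphic_derivative:
  fixes f :: "complex ^ 'n::finite \<Rightarrow> complex"
  assumes S: "open S" and f: "mholomorphic_on S f"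
    and f': "\<And>z. z \<in> S \<Longrightarrow> (f has_derivative f' z) (at z)"
  shows "mholomorphic_on S (\<lambda>z. f' z v)"
proof -
  have contf: "continuous_on S f"
    using f' has_derivative_continuous continuous_at_imp_continuous_on by blast
  have cont_path: "continuous_on (U \<times> {0..1}) (\<lambda>(z, t). g (z + c t *s v) / c t)"
    if "continuous_on S g" "continuous_on {0..1::real} c" "\<forall>t. c t \<noteq> 0"
      "\<forall>z\<in>U. \<forall>t\<in>{0..1}. z + c t *s v \<in> S"
    for U g v and c :: "real \<Rightarrow> complex"
  proof -
    have c: "continuous_on (U \<times> {0..1}) (\<lambda>p. c (snd p))"
      by (rule continuous_on_compose2[OF that(2) continuous_on_snd[OF continuous_on_id]]) auto
    have "continuous_on (U \<times> {0..1}) (\<lambda>p. g (fst p + c (snd p) *s v))"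
      by (rule continuous_on_compose2[OF that(1)])
        (use that(4) in \<open>auto intro!: continuous_on_add continuous_on_fst c
            bounded_bilinear.continuous_on[OF bounded_bilinear_vector_scalar_mult]\<close>)
    then show ?thesis
      unfolding split_def using c that(3) by (intro continuous_on_divide) auto
  qed
  have cont': "continuous_on S (\<lambda>z. f' z w)" for w
  proof (rule continuous_at_imp_continuous_on, rule ballI)
    fix z0 assume z0: "z0 \<in> S"
    obtain U c where U: "open U" "convex U" "z0 \<in> U" "U \<subseteq> S" "continuous_on {0..1::real} c"
      "\<forall>t. c t \<noteq> 0" "\<forall>z\<in>U. \<forall>t\<in>{0..1}. z + c t *s w \<in> S"
      "\<forall>z\<in>U. f' z w = integral {0..1} (\<lambda>t. f (z + c t *s w) / c t)"
      by (rule mholomorphic_directional_derivative[OF S f f' z0, where v = w]) (assumption, rule that)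
    have "continuous_on U (\<lambda>z. integral {0..1} (\<lambda>t. f (z + c t *s w) / c t))"
      by (intro continuous_on_parametric_integral cont_path contf U)
    then have "continuous_on U (\<lambda>z. f' z w)"
      using U(8) by (simp cong: continuous_on_cong)
    then show "isCont (\<lambda>z. f' z w) z0"
      using U continuous_on_eq_continuous_at by blast
  qed
  show ?thesis
    unfolding mholomorphic_on_def
  proof
    fix z0 assume z0: "z0 \<in> S"
    obtain U c where U: "open U" "convex U" "z0 \<in> U" "U \<subseteq> S" "continuous_on {0..1::real} c"
      "\<forall>t. c t \<noteq> 0" "\<forall>z\<in>U. \<forall>t\<in>{0..1}. z + c t *s v \<in> S"
      "\<forall>z\<in>U. f' z v = integral {0..1} (\<lambda>t. f (z + c t *s v) / c t)"
      by (rule mholomorphic_directional_derivative[OF S f f' z0, where v = v]) (assumption, rule that)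
    let ?G' = "\<lambda>w. integral {0..1} (\<lambda>t. f' (z0 + c t *s v) w / c t)"
    have "((\<lambda>z. integral {0..1} (\<lambda>t. f (z + c t *s v) / c t)) has_derivative ?G') (at z0)"
    proof (rule has_derivative_parametric_integral[OF U(1,2) _ _ _ U(3)])
      fix z t assume zt: "z \<in> U" "t \<in> {0..1::real}"
      have "((\<lambda>z. z + c t *s v) has_derivative (\<lambda>w. w)) (at z)"
        using has_derivative_add[OF has_derivative_ident has_derivative_const] by fastforce
      from has_derivative_compose[OF this f'[OF U(7)[rule_format, OF zt]]]
      show "((\<lambda>z. f (z + c t *s v) / c t) has_derivative (\<lambda>w. f' (z + c t *s v) w / c t)) (at z)"
        using bounded_linear.has_derivative[OF bounded_linear_divide] by blast
    next
      fix z assume "z \<in> U"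
      then show "continuous_on {0..1} (\<lambda>t. f (z + c t *s v) / c t)"
        by (rule continuous_on_section[OF cont_path[OF contf U(5,6,7)]])
    next
      fix w
      show "continuous_on (U \<times> {0..1}) (\<lambda>(z, t). f' (z + c t *s v) w / c t)"
        by (intro cont_path cont' U)
    qed
    then have "((\<lambda>z. f' z v) has_derivative ?G') (at z0)"
      by (rule has_derivative_transform_within_open[OF _ U(1,3)]) (use U(8) in auto)
    moreover have "?G' (k *s w) = k * ?G' w" for k w
    proof -
      have "?G' (k *s w) = integral {0..1} (\<lambda>t. k * (f' (z0 + c t *s v) w / c t))"
        using mholomorphic_onD[OF f U(7)[rule_format, OF U(3)] f'[OF U(7)[rule_format, OF U(3)]]]
        by (intro integral_cong) simp
      also have "\<dots> = k * ?G' w" by (rule integral_mult_right)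
      finally show ?thesis .
    qed
    ultimately show "\<exists>G'. ((\<lambda>z. f' z v) has_derivative G') (at z0) \<and> (\<forall>k w. G' (k *s w) = k * G' w)"
      by blast
  qed
qed

lemma mholomorphic_imp_Ck:
  fixes f :: "complex ^ 'n::finite \<Rightarrow> complex"
  assumes S: "open S"
  shows "mholomorphic_on S f \<Longrightarrow> Ck k S f"
proof (induction k arbitrary: f)
  case 0
  then show ?case
    by (auto simp: mholomorphic_on_def intro!: continuous_at_imp_continuous_on dest: has_derivative_continuous)
next
  case (Suc k)
  obtain f' where f': "\<forall>z\<in>S. (f has_derivative f' z) (at z)"
    using bchoice[of S "\<lambda>z f'. (f has_derivative f') (at z)"] Suc.prems
    unfolding mholomorphic_on_def by blast
  have "Ck k S (\<lambda>z. f' z v)" for v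
    by (rule Suc.IH, rule mholomorphic_derivative[OF S Suc.prems]) (use f' in auto)
  with f' show ?case by auto
qed

section \<open>Hadamard's lemma\<close>

lemma mem_ball_radial:
  fixes p :: "'a::real_normed_vector"
  assumes "z \<in> ball p r" "t \<in> {0..1}"
  shows "p + t *\<^sub>R (z - p) \<in> ball p r"
proof -
  have "norm (t *\<^sub>R (z - p)) \<le> norm (z - p)"
    using assms(2) by (simp add: mult_left_le_one_le)
  then show ?thesis
    using assms(1) by (simp add: dist_norm norm_minus_commute)
qed

text \<open>The power of \<open>t\<close> makes the statement inductive: each derivative in \<open>z\<close> of \<open>h (p + t *\<^sub>R (z - p))\<close>
  produces one more factor \<open>t\<close>.\<close>

lemma Ck_radial_integral:
  fixes h :: "'a::euclidean_space \<Rightarrow> 'b::banach"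
  shows "Ck k (ball p r) h \<Longrightarrow>
    Ck k (ball p r) (\<lambda>z. integral {0..1} (\<lambda>t. t ^ m *\<^sub>R h (p + t *\<^sub>R (z - p))))"
proof (induction k arbitrary: h m)
  have cont: "continuous_on (ball p r \<times> {0..1}) (\<lambda>(z, t). t ^ m *\<^sub>R h (p + t *\<^sub>R (z - p)))"
    if "continuous_on (ball p r) h" for h :: "'a \<Rightarrow> 'b" and m
  proof -
    have "continuous_on (ball p r \<times> {0..1}) (\<lambda>x. h (p + snd x *\<^sub>R (fst x - p)))"
      by (rule continuous_on_compose2[OF that])
        (use mem_ball_radial[of _ p r] in \<open>auto intro!: continuous_intros simp del: mem_ball\<close>)
    then show ?thesis
      unfolding split_def by (intro continuous_intros)
  qed
  {
    case 0
    then show ?case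
      using continuous_on_parametric_integral[OF cont] by simp
  next
    case (Suc k)
    obtain h' where h': "\<forall>x\<in>ball p r. (h has_derivative h' x) (at x)"
        "\<forall>v. Ck k (ball p r) (\<lambda>x. h' x v)"
      using Suc.prems by auto
    have Ck0: "continuous_on (ball p r) f" if "Ck j (ball p r) f" for j and f :: "'a \<Rightarrow> 'b"
      using that by (induction j) (use Ck_lower in auto)
    show ?case
    proof (rule Ck_SucI)
      fix z assume z: "z \<in> ball p r"
      show "((\<lambda>z. integral {0..1} (\<lambda>t. t ^ m *\<^sub>R h (p + t *\<^sub>R (z - p)))) has_derivative
         (\<lambda>v. integral {0..1} (\<lambda>t. t ^ Suc m *\<^sub>R h' (p + t *\<^sub>R (z - p)) v))) (at z)"
      proof (rule has_derivative_parametric_integral[OF open_ball convex_ball _ _ _ z])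
        fix z and t :: real
        assume zt: "z \<in> ball p r" "t \<in> {0..1}"
        note h'z = h'(1)[rule_format, OF mem_ball_radial[OF zt]]
        have "((\<lambda>z. p + t *\<^sub>R (z - p)) has_derivative (\<lambda>v. t *\<^sub>R v)) (at z)"
          by (auto intro!: derivative_eq_intros)
        from has_derivative_scaleR_right[OF has_derivative_compose[OF this h'z], of "t ^ m"]
        show "((\<lambda>z. t ^ m *\<^sub>R h (p + t *\<^sub>R (z - p))) has_derivative
            (\<lambda>v. t ^ Suc m *\<^sub>R h' (p + t *\<^sub>R (z - p)) v)) (at z)"
          by (simp add: linear_cmul[OF has_derivative_linear[OF h'z]] mult.commute)
      next
        fix z assume "z \<in> ball p r"
        then show "continuous_on {0..1} (\<lambda>t. t ^ m *\<^sub>R h (p + t *\<^sub>R (z - p)))"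
          by (rule continuous_on_section[OF cont[OF Ck0[OF Suc.prems]]])
      next
        fix v
        show "continuous_on (ball p r \<times> {0..1}) (\<lambda>(z, t). t ^ Suc m *\<^sub>R h' (p + t *\<^sub>R (z - p)) v)"
          by (rule cont) (use h'(2) Ck0 in blast)
      qed
    next
      fix v
      show "Ck k (ball p r) (\<lambda>z. integral {0..1} (\<lambda>t. t ^ Suc m *\<^sub>R h' (p + t *\<^sub>R (z - p)) v))"
        using h'(2) by (intro Suc.IH) simp
    qed
  }
qed

lemma Csmooth_has_derivative:
  assumes "Csmooth S f" "x \<in> S"
  shows "(f has_derivative frechet_derivative f (at x)) (at x)"
proof -
  have "Ck (Suc 0) S f" using assms(1) by (simp add: Csmooth_def del: Ck.simps)
  then have "f differentiable at x"
    using assms(2) by (auto simp: differentiable_def)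
  then show ?thesis by (simp add: frechet_derivative_works)
qed

text \<open>A smooth function comes with a separate derivative for each order \<open>k\<close>; by uniqueness of
  derivatives they all agree with the Frechet derivative.\<close>

lemma Csmooth_directional_derivative:
  assumes "open S" "Csmooth S f"
  shows "Csmooth S (\<lambda>x. frechet_derivative f (at x) v)"
  unfolding Csmooth_def
proof
  fix k
  have "Ck (Suc k) S f" using assms(2) by (simp add: Csmooth_def del: Ck.simps)
  then obtain f' where f': "\<forall>x\<in>S. (f has_derivative f' x) (at x)" "\<forall>v. Ck k S (\<lambda>x. f' x v)"
    by auto
  show "Ck k S (\<lambda>x. frechet_derivative f (at x) v)"
    by (rule Ck_cong[OF assms(1) _ f'(2)[rule_format, of v]])
      (use f'(1) frechet_derivative_at in metis)
qed

text \<open>Integrating the derivative of \<open>f\<close> along the segment from \<open>p\<close> to \<open>z\<close> and expanding \<open>z - p\<close> in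
  coordinates gives the factors \<open>g i z = \<integral>\<^sub>0\<^sup>1 f' (p + t (z - p)) i dt\<close>. The point of the lemma is that
  these quotients are again smooth, so that a derivation can be applied to the products.\<close>

lemma Hadamard:
  fixes f :: "'a::euclidean_space \<Rightarrow> complex"
  assumes f: "Csmooth (ball p r) f" and r: "r > 0"
  obtains g where "\<And>i. Csmooth (ball p r) (g i)"
    "\<And>z. z \<in> ball p r \<Longrightarrow> f z = f p + (\<Sum>i\<in>Basis. of_real ((z - p) \<bullet> i) * g i z)"
    "\<And>i. g i p = frechet_derivative f (at p) i"
proof -
  define f' where "f' z = frechet_derivative f (at z)" for z
  define g where "g i z = integral {0..1} (\<lambda>t. f' (p + t *\<^sub>R (z - p)) i)" for i z
  have f': "(f has_derivative f' z) (at z)" if "z \<in> ball p r" for z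
    unfolding f'_def by (rule Csmooth_has_derivative[OF f that])
  have smooth': "Csmooth (ball p r) (\<lambda>z. f' z v)" for v
    unfolding f'_def by (rule Csmooth_directional_derivative[OF open_ball f])
  have g: "Csmooth (ball p r) (g i)" for i
    using smooth' Ck_radial_integral[where m = 0 and p = p and r = r] unfolding g_def Csmooth_def by auto
  have "f z = f p + (\<Sum>i\<in>Basis. of_real ((z - p) \<bullet> i) * g i z)" if z: "z \<in> ball p r" for z
  proof -
    have lin: "linear (f' (p + t *\<^sub>R (z - p)))" if "t \<in> {0..1}" for t
      by (rule has_derivative_linear[OF f'[OF mem_ball_radial[OF z that]]])
    have "((\<lambda>t. f' (p + t *\<^sub>R (z - p)) (z - p)) has_integral
        f (p + 1 *\<^sub>R (z - p)) - f (p + 0 *\<^sub>R (z - p))) {0..1}"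
    proof (rule fundamental_theorem_of_calculus)
      fix t :: real assume t: "t \<in> {0..1}"
      have "((\<lambda>t. p + t *\<^sub>R (z - p)) has_derivative (\<lambda>h. h *\<^sub>R (z - p))) (at t within {0..1})"
        by (auto intro!: derivative_eq_intros)
      from has_derivative_compose[OF this f'[OF mem_ball_radial[OF z t]]]
      show "((\<lambda>t. f (p + t *\<^sub>R (z - p))) has_vector_derivative f' (p + t *\<^sub>R (z - p)) (z - p))
          (at t within {0..1})"
        by (simp add: has_vector_derivative_def linear_cmul[OF lin[OF t]])
    qed simp
    then have "f z - f p = integral {0..1} (\<lambda>t. f' (p + t *\<^sub>R (z - p)) (z - p))"
      by (simp add: integral_unique)
    also have "\<dots> = integral {0..1} (\<lambda>t. \<Sum>i\<in>Basis. of_real ((z - p) \<bullet> i) * f' (p + t *\<^sub>R (z - p)) i)"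
    proof (rule integral_cong)
      fix t :: real assume t: "t \<in> {0..1}"
      have "f' (p + t *\<^sub>R (z - p)) (z - p) =
          f' (p + t *\<^sub>R (z - p)) (\<Sum>i\<in>Basis. ((z - p) \<bullet> i) *\<^sub>R i)"
        by (simp add: euclidean_representation)
      then show "f' (p + t *\<^sub>R (z - p)) (z - p) =
          (\<Sum>i\<in>Basis. of_real ((z - p) \<bullet> i) * f' (p + t *\<^sub>R (z - p)) i)"
        by (simp only: linear_sum[OF lin[OF t]] linear_cmul[OF lin[OF t]] scaleR_conv_of_real)
    qed
    also have "\<dots> = (\<Sum>i\<in>Basis. of_real ((z - p) \<bullet> i) * g i z)"
    proof -
      have "(\<lambda>t. f' (p + t *\<^sub>R (z - p)) i) integrable_on {0..1}" for i
      proof (rule integrable_continuous_interval)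
        have "continuous_on (ball p r) (\<lambda>z. f' z i)"
          using smooth'[of i] unfolding Csmooth_def by (metis Ck.simps(1))
        then show "continuous_on {0..1} (\<lambda>t. f' (p + t *\<^sub>R (z - p)) i)"
          by (rule continuous_on_compose2)
            (use mem_ball_radial[OF z] in \<open>auto intro!: continuous_intros simp del: mem_ball\<close>)
      qed
      then have "integral {0..1} (\<lambda>t. \<Sum>i\<in>Basis. of_real ((z - p) \<bullet> i) * f' (p + t *\<^sub>R (z - p)) i) =
          (\<Sum>i\<in>Basis. integral {0..1} (\<lambda>t. of_real ((z - p) \<bullet> i) * f' (p + t *\<^sub>R (z - p)) i))"
        by (intro integral_sum integrable_on_mult_right) auto
      then show ?thesis by (simp add: g_def)
    qed
    finally show ?thesis by (simp add: algebra_simps)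
  qed
  moreover have "g i p = frechet_derivative f (at p) i" for i
    by (simp add: g_def f'_def)
  ultimately show ?thesis using that g by blast
qed

section \<open>Smooth functions on a complex manifold\<close>

lemma chartD:
  assumes "complex_manifold A" "(U, \<phi>) \<in> A"
  shows "open U" "open (\<phi> ` U)" "homeomorphism U (\<phi> ` U) \<phi> (inv_into U \<phi>)"
    "continuous_on U \<phi>" "y \<in> U \<Longrightarrow> inv_into U \<phi> (\<phi> y) = y"
  using assms unfolding complex_manifold_def by (auto simp: homeomorphism_def split: prod.splits)

lemma obtain_chart:
  assumes "complex_manifold A"
  obtains U \<phi> where "(U, \<phi>) \<in> A" "x \<in> U"
proof -
  have "x \<in> (\<Union>(U, \<phi>)\<in>A. U)"
    using assms unfolding complex_manifold_def by simp
  then show ?thesis using that by auto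
qed

lemma open_chart_image:
  assumes "complex_manifold A" "(U, \<phi>) \<in> A" "open W"
  shows "open (\<phi> ` (W \<inter> U))"
proof -
  note c = chartD[OF assms(1,2)]
  have "openin (top_of_set (\<phi> ` U)) (\<phi> ` (W \<inter> U))"
    by (rule homeomorphism_imp_open_map[OF c(3)]) (use assms(3) in \<open>auto simp: openin_open\<close>)
  then show ?thesis using c(2) openin_open_eq by blast
qed

text \<open>Coordinate changes are holomorphic component by component; the vector is reassembled from its
  smooth components.\<close>

lemma Ck_transition:
  fixes A :: "('x::{t2_space, second_countable_topology}, 'n::finite) atlas"
  assumes "complex_manifold A" "(U, \<phi>) \<in> A" "(V, \<psi>) \<in> A"
  shows "Ck k (\<phi> ` (U \<inter> V)) (\<lambda>z. \<psi> (inv_into U \<phi> z))"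
proof -
  have "mholomorphic_on (\<phi> ` (U \<inter> V)) (\<lambda>z. \<psi> (inv_into U \<phi> z) $ j)" for j
    using assms unfolding complex_manifold_def by fastforce
  moreover have "open (\<phi> ` (U \<inter> V))"
    using open_chart_image[OF assms(1,2) chartD(1)[OF assms(1,3)]] by (simp add: Int_commute)
  ultimately have "Ck k (\<phi> ` (U \<inter> V)) (\<lambda>z. \<psi> (inv_into U \<phi> z) $ j)" for j
    using mholomorphic_imp_Ck by blast
  moreover have "bounded_linear (axis j :: complex \<Rightarrow> complex ^ 'n)" for j
    unfolding linear_conv_bounded_linear[symmetric]
    by (rule linearI) (auto simp: vec_eq_iff axis_def)
  ultimately have "Ck k (\<phi> ` (U \<inter> V)) (\<lambda>z. \<Sum>j\<in>UNIV. axis j (\<psi> (inv_into U \<phi> z) $ j))"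
    by (auto intro!: Ck_sum intro: Ck_bounded_linear[of "axis _"])
  moreover have "(\<Sum>j\<in>UNIV. axis j (w $ j)) = w" for w :: "complex ^ 'n"
    by (simp add: vec_eq_iff axis_def if_distrib cong: if_cong)
  ultimately show ?thesis by simp
qed

lemma smooth_fun_on_cong:
  assumes "complex_manifold A" "open W" "\<And>x. x \<in> W \<Longrightarrow> f x = g x" "smooth_fun_on A W f"
  shows "smooth_fun_on A W g"
  unfolding smooth_fun_on_def Csmooth_def
proof clarify
  fix U \<phi> k assume c: "(U, \<phi>) \<in> A"
  show "Ck k (\<phi> ` (W \<inter> U)) (\<lambda>z. g (inv_into U \<phi> z))"
  proof (rule Ck_cong[OF open_chart_image[OF assms(1) c assms(2)]])
    show "Ck k (\<phi> ` (W \<inter> U)) (\<lambda>z. f (inv_into U \<phi> z))"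
      using assms(4) c unfolding smooth_fun_on_def Csmooth_def by fast
  qed (use assms(3) chartD(5)[OF assms(1) c] in auto)
qed

text \<open>Smoothness refers to all charts of the atlas. One chart around \<open>W\<close> decides, because the
  expression in another one arises by composition with a smooth coordinate change.\<close>

lemma smooth_fun_on_chartI:
  assumes A: "complex_manifold A" "(U, \<phi>) \<in> A" and W: "open W" "W \<subseteq> U"
    and h: "Csmooth (\<phi> ` W) h"
  shows "smooth_fun_on A W (\<lambda>y. h (\<phi> y))"
  unfolding smooth_fun_on_def Csmooth_def
proof clarify
  fix V \<psi> k assume c: "(V, \<psi>) \<in> A"
  have "Ck k (\<psi> ` (W \<inter> V)) (\<lambda>z. \<phi> (inv_into V \<psi> z))"
    by (rule Ck_subset[OF Ck_transition[OF A(1) c A(2)]]) (use W in auto)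
  then show "Ck k (\<psi> ` (W \<inter> V)) (\<lambda>z. h (\<phi> (inv_into V \<psi> z)))"
    by (rule Ck_compose[where T = "\<phi> ` W", rotated 2])
      (use h chartD(5)[OF A(1) c] in \<open>auto simp: Csmooth_def\<close>)
qed

lemma smooth_fun_on_subset: "smooth_fun_on A W f \<Longrightarrow> W' \<subseteq> W \<Longrightarrow> smooth_fun_on A W' f"
  unfolding smooth_fun_on_def Csmooth_def by (fast intro: Ck_subset)

lemma smooth_fun_on_const: "smooth_fun_on A W (\<lambda>x. c)"
  unfolding smooth_fun_on_def Csmooth_def by (auto intro: Ck_const)

lemma smooth_fun_on_add:
  "smooth_fun_on A W f \<Longrightarrow> smooth_fun_on A W g \<Longrightarrow> smooth_fun_on A W (\<lambda>x. f x + g x)"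
  unfolding smooth_fun_on_def Csmooth_def by (fast intro: Ck_add)

lemma smooth_fun_on_mult:
  "smooth_fun_on A W f \<Longrightarrow> smooth_fun_on A W g \<Longrightarrow> smooth_fun_on A W (\<lambda>x. f x * g x)"
  unfolding smooth_fun_on_def Csmooth_def by (fast intro: Ck_bounded_bilinear[OF bounded_bilinear_mult])

lemma smooth_fun_on_cnj: "smooth_fun_on A W f \<Longrightarrow> smooth_fun_on A W (\<lambda>x. cnj (f x))"
  unfolding smooth_fun_on_def Csmooth_def by (fast intro: Ck_bounded_linear[OF bounded_linear_cnj])

lemma smooth_nearI: "open W \<Longrightarrow> x \<in> W \<Longrightarrow> smooth_fun_on A W f \<Longrightarrow> smooth_near A x f"
  by (auto simp: smooth_near_def)

lemma smooth_near_const: "smooth_near A x (\<lambda>y. c)"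
  by (rule smooth_nearI[of UNIV]) (auto intro: smooth_fun_on_const)

lemma smooth_near_common:
  assumes "smooth_near A x f" "smooth_near A x g"
  obtains W where "open W" "x \<in> W" "smooth_fun_on A W f" "smooth_fun_on A W g"
proof -
  obtain W W' where "open W" "x \<in> W" "smooth_fun_on A W f" "open W'" "x \<in> W'" "smooth_fun_on A W' g"
    using assms unfolding smooth_near_def by blast
  then show ?thesis
    by (intro that[of "W \<inter> W'"]) (auto intro: smooth_fun_on_subset)
qed

lemma smooth_near_add:
  "smooth_near A x f \<Longrightarrow> smooth_near A x g \<Longrightarrow> smooth_near A x (\<lambda>y. f y + g y)"
  by (erule (1) smooth_near_common) (auto intro: smooth_nearI smooth_fun_on_add)

lemma smooth_near_mult:
  "smooth_near A x f \<Longrightarrow> smooth_near A x g \<Longrightarrow> smooth_near A x (\<lambda>y. f y * g y)"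
  by (erule (1) smooth_near_common) (auto intro: smooth_nearI smooth_fun_on_mult)

lemma smooth_near_sum:
  "(\<And>i. i \<in> I \<Longrightarrow> smooth_near A x (f i)) \<Longrightarrow> smooth_near A x (\<lambda>y. \<Sum>i\<in>I. f i y)"
  by (induction I rule: infinite_finite_induct) (auto intro: smooth_near_const smooth_near_add)

lemma smooth_near_cnj: "smooth_near A x (\<lambda>y. cnj (f y)) \<longleftrightarrow> smooth_near A x f"
proof -
  have "smooth_near A x f \<Longrightarrow> smooth_near A x (\<lambda>y. cnj (f y))" for f
    unfolding smooth_near_def using smooth_fun_on_cnj by blast
  from this[of f] this[of "\<lambda>y. cnj (f y)"] show ?thesis by auto
qed

lemma smooth_near_eventually: "smooth_near A x f \<Longrightarrow> \<forall>\<^sub>F y in nhds x. smooth_near A y f"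
  unfolding smooth_near_def eventually_nhds by blast

lemma smooth_near_cong:
  assumes "complex_manifold A" "smooth_near A x f" "\<forall>\<^sub>F y in nhds x. f y = g y"
  shows "smooth_near A x g"
proof -
  obtain W W' where W: "open W" "x \<in> W" "smooth_fun_on A W f" and
      W': "open W'" "x \<in> W'" "\<And>y. y \<in> W' \<Longrightarrow> f y = g y"
    using assms unfolding smooth_near_def eventually_nhds by blast
  have "smooth_fun_on A (W \<inter> W') f"
    using W(3) by (rule smooth_fun_on_subset) auto
  then have "smooth_fun_on A (W \<inter> W') g"
    by (rule smooth_fun_on_cong[OF assms(1), rotated 2]) (use W W' in auto)
  then show ?thesis
    by (rule smooth_nearI[rotated 2]) (use W W' in auto)
qed

section \<open>Tangent vectors and vector fields\<close>

lemma tangentD: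
  assumes "\<xi> \<in> tangent A x"
  shows "smooth_near A x f \<Longrightarrow> smooth_near A x g \<Longrightarrow> \<xi> (\<lambda>y. f y + g y) = \<xi> f + \<xi> g"
    and "smooth_near A x f \<Longrightarrow> \<xi> (\<lambda>y. c * f y) = c * \<xi> f"
    and "smooth_near A x f \<Longrightarrow> smooth_near A x g \<Longrightarrow> \<xi> (\<lambda>y. f y * g y) = \<xi> f * g x + f x * \<xi> g"
    and "smooth_near A x f \<Longrightarrow> \<forall>\<^sub>F y in nhds x. f y = g y \<Longrightarrow> \<xi> f = \<xi> g"
    and "\<not> smooth_near A x f \<Longrightarrow> \<xi> f = 0"
  using assms by (auto simp: tangent_def)

lemma tangentI:
  assumes "\<And>f g. smooth_near A x f \<Longrightarrow> smooth_near A x g \<Longrightarrow> \<xi> (\<lambda>y. f y + g y) = \<xi> f + \<xi> g"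
    and "\<And>c f. smooth_near A x f \<Longrightarrow> \<xi> (\<lambda>y. c * f y) = c * \<xi> f"
    and "\<And>f g. smooth_near A x f \<Longrightarrow> smooth_near A x g \<Longrightarrow>
      \<xi> (\<lambda>y. f y * g y) = \<xi> f * g x + f x * \<xi> g"
    and "\<And>f g. smooth_near A x f \<Longrightarrow> \<forall>\<^sub>F y in nhds x. f y = g y \<Longrightarrow> \<xi> f = \<xi> g"
    and "\<And>f. \<not> smooth_near A x f \<Longrightarrow> \<xi> f = 0"
  shows "\<xi> \<in> tangent A x"
  using assms unfolding tangent_def by blast

lemma tangent_const:
  assumes "\<xi> \<in> tangent A x"
  shows "\<xi> (\<lambda>y. c) = 0"
proof -
  have "\<xi> (\<lambda>y. 1) = 0"
    using tangentD(3)[OF assms smooth_near_const smooth_near_const, of 1 1] by simp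
  then show ?thesis
    using tangentD(2)[OF assms smooth_near_const, of c 1] by simp
qed

lemma tangent_apply_sum:
  assumes "\<xi> \<in> tangent A x"
  shows "(\<And>i. i \<in> I \<Longrightarrow> smooth_near A x (f i)) \<Longrightarrow> \<xi> (\<lambda>y. \<Sum>i\<in>I. f i y) = (\<Sum>i\<in>I. \<xi> (f i))"
  by (induction I rule: infinite_finite_induct)
    (auto simp: tangent_const[OF assms] tangentD(1)[OF assms] smooth_near_sum)

lemma tangent_lincomb:
  assumes "\<And>i. i \<in> I \<Longrightarrow> \<tau> i \<in> tangent A x"
  shows "(\<lambda>f. \<Sum>i\<in>I. c i * \<tau> i f) \<in> tangent A x"
proof (rule tangentI)
  fix f g assume fg: "smooth_near A x f" "smooth_near A x g"
  show "(\<Sum>i\<in>I. c i * \<tau> i (\<lambda>y. f y + g y)) = (\<Sum>i\<in>I. c i * \<tau> i f) + (\<Sum>i\<in>I. c i * \<tau> i g)"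
    unfolding sum.distrib[symmetric]
    by (rule sum.cong) (auto simp: tangentD(1)[OF assms fg] algebra_simps)
  show "(\<Sum>i\<in>I. c i * \<tau> i (\<lambda>y. f y * g y)) = (\<Sum>i\<in>I. c i * \<tau> i f) * g x + f x * (\<Sum>i\<in>I. c i * \<tau> i g)"
    unfolding sum_distrib_left sum_distrib_right sum.distrib[symmetric]
    by (rule sum.cong) (auto simp: tangentD(3)[OF assms fg] algebra_simps)
next
  fix f k assume "smooth_near A x f"
  then show "(\<Sum>i\<in>I. c i * \<tau> i (\<lambda>y. k * f y)) = k * (\<Sum>i\<in>I. c i * \<tau> i f)"
    unfolding sum_distrib_left
    by (intro sum.cong) (auto simp: tangentD(2)[OF assms] algebra_simps)
next
  fix f g assume fg: "smooth_near A x f" "\<forall>\<^sub>F y in nhds x. f y = g y"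
  show "(\<Sum>i\<in>I. c i * \<tau> i f) = (\<Sum>i\<in>I. c i * \<tau> i g)"
    by (rule sum.cong) (auto simp: tangentD(4)[OF assms fg])
next
  fix f assume "\<not> smooth_near A x f"
  then show "(\<Sum>i\<in>I. c i * \<tau> i f) = 0"
    by (simp add: tangentD(5)[OF assms])
qed

lemma tangent10_lincomb:
  assumes "\<And>i. i \<in> I \<Longrightarrow> \<tau> i \<in> tangent10 A x"
  shows "(\<lambda>f. \<Sum>i\<in>I. c i * \<tau> i f) \<in> tangent10 A x"
  using assms tangent_lincomb[of I \<tau> A x c] by (auto simp: tangent10_def)

lemma tangent01_lincomb:
  assumes "\<And>i. i \<in> I \<Longrightarrow> \<tau> i \<in> tangent01 A x"
  shows "(\<lambda>f. \<Sum>i\<in>I. c i * \<tau> i f) \<in> tangent01 A x"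
  using assms tangent_lincomb[of I \<tau> A x c] by (auto simp: tangent01_def)

lemma cnj_tvec_cnj_tvec [simp]: "cnj_tvec (cnj_tvec \<xi>) = \<xi>"
  by (simp add: cnj_tvec_def)

lemma cnj_tvec_in_tangent:
  assumes "\<xi> \<in> tangent A x"
  shows "cnj_tvec \<xi> \<in> tangent A x"
proof (rule tangentI)
  fix f g assume fg: "smooth_near A x f" "smooth_near A x g"
  then have c: "smooth_near A x (\<lambda>y. cnj (f y))" "smooth_near A x (\<lambda>y. cnj (g y))"
    by (simp_all add: smooth_near_cnj)
  show "cnj_tvec \<xi> (\<lambda>y. f y + g y) = cnj_tvec \<xi> f + cnj_tvec \<xi> g"
    using tangentD(1)[OF assms c] by (simp add: cnj_tvec_def)
  show "cnj_tvec \<xi> (\<lambda>y. f y * g y) = cnj_tvec \<xi> f * g x + f x * cnj_tvec \<xi> g"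
    using tangentD(3)[OF assms c] by (simp add: cnj_tvec_def)
next
  fix f k assume "smooth_near A x f"
  then show "cnj_tvec \<xi> (\<lambda>y. k * f y) = k * cnj_tvec \<xi> f"
    using tangentD(2)[OF assms, of "\<lambda>y. cnj (f y)" "cnj k"] by (simp add: cnj_tvec_def smooth_near_cnj)
next
  fix f g assume "smooth_near A x f" "\<forall>\<^sub>F y in nhds x. f y = g y"
  then show "cnj_tvec \<xi> f = cnj_tvec \<xi> g"
    using tangentD(4)[OF assms, of "\<lambda>y. cnj (f y)" "\<lambda>y. cnj (g y)"]
    by (simp add: cnj_tvec_def smooth_near_cnj)
next
  fix f assume "\<not> smooth_near A x f"
  then show "cnj_tvec \<xi> f = 0"
    using tangentD(5)[OF assms, of "\<lambda>y. cnj (f y)"] by (simp add: cnj_tvec_def smooth_near_cnj)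
qed

lemma cnj_tvec_tangent10: "\<xi> \<in> tangent10 A x \<Longrightarrow> cnj_tvec \<xi> \<in> tangent01 A x"
  by (auto simp: tangent10_def tangent01_def cnj_tvec_in_tangent) (simp add: cnj_tvec_def)

lemma smooth_field_cnj_field: "smooth_field A V \<Longrightarrow> smooth_field A (cnj_field V)"
  unfolding smooth_field_def cnj_field_def
  by (auto simp: cnj_tvec_in_tangent) (auto simp: cnj_tvec_def intro!: smooth_fun_on_cnj)

lemma smooth_field_smooth_near: "smooth_field A V \<Longrightarrow> smooth_near A x f \<Longrightarrow> smooth_near A x (\<lambda>y. V y f)"
  unfolding smooth_near_def smooth_field_def by blast

text \<open>In the second-order Leibniz rule for \<open>V (W (f g))\<close> the mixed terms \<open>V f \<cdot> W g + W f \<cdot> V g\<close> are symmetric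
  in \<open>V\<close> and \<open>W\<close> and cancel in the commutator. The identities for \<open>W f\<close> hold only at the points
  where \<open>f\<close> and \<open>g\<close> are smooth, that is, near \<open>x\<close>; therefore the locality of tangent vectors is
  used at every step.\<close>

lemma lie_bracket_in_tangent:
  assumes A: "complex_manifold A" and V: "smooth_field A V" and W: "smooth_field A W"
  shows "lie_bracket A V W x \<in> tangent A x"
proof -
  have V': "V y \<in> tangent A y" and W': "W y \<in> tangent A y" for y
    using V W by (auto simp: smooth_field_def)
  note near = smooth_field_smooth_near[OF V] smooth_field_smooth_near[OF W]
  have iter: "\<xi> (\<lambda>y. Y y f) = \<xi> g"
    if "\<xi> \<in> tangent A x" "smooth_near A x g" "\<forall>\<^sub>F y in nhds x. Y y f = g y"
    for \<xi> and Y :: "'a vfield" and f g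
  proof -
    have "\<forall>\<^sub>F y in nhds x. g y = Y y f" using that(3) by eventually_elim simp
    then show ?thesis using tangentD(4)[OF that(1,2)] by metis
  qed
  have add: "\<xi> (\<lambda>y. Y y (\<lambda>z. f z + g z)) = \<xi> (\<lambda>y. Y y f) + \<xi> (\<lambda>y. Y y g)"
    if X: "\<xi> \<in> tangent A x" and Y: "smooth_field A Y" and fg: "smooth_near A x f" "smooth_near A x g"
    for \<xi> and Y :: "'a vfield" and f g
  proof -
    have Y': "Y y \<in> tangent A y" for y using Y by (simp add: smooth_field_def)
    have "\<forall>\<^sub>F y in nhds x. Y y (\<lambda>z. f z + g z) = Y y f + Y y g"
      using fg[THEN smooth_near_eventually]
      by eventually_elim (rule tangentD(1)[OF Y'])
    then show ?thesis
      using iter[OF X smooth_near_add[OF fg[THEN smooth_field_smooth_near[OF Y]]], of Y]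
        tangentD(1)[OF X fg[THEN smooth_field_smooth_near[OF Y]]] by simp
  qed
  have scale: "\<xi> (\<lambda>y. Y y (\<lambda>z. c * f z)) = c * \<xi> (\<lambda>y. Y y f)"
    if X: "\<xi> \<in> tangent A x" and Y: "smooth_field A Y" and f: "smooth_near A x f"
    for \<xi> and Y :: "'a vfield" and f c
  proof -
    have Y': "Y y \<in> tangent A y" for y using Y by (simp add: smooth_field_def)
    have "\<forall>\<^sub>F y in nhds x. Y y (\<lambda>z. c * f z) = c * Y y f"
      using f[THEN smooth_near_eventually]
      by eventually_elim (rule tangentD(2)[OF Y'])
    moreover have "smooth_near A x (\<lambda>y. c * Y y f)"
      by (intro smooth_near_mult smooth_near_const smooth_field_smooth_near[OF Y] f)
    ultimately show ?thesis
      using iter[OF X, of _ Y] tangentD(2)[OF X smooth_field_smooth_near[OF Y f]] by simp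
  qed
  have mult: "\<xi> (\<lambda>y. Y y (\<lambda>z. f z * g z)) =
      \<xi> (\<lambda>y. Y y f) * g x + Y x f * \<xi> g + \<xi> f * Y x g + f x * \<xi> (\<lambda>y. Y y g)"
    if X: "\<xi> \<in> tangent A x" and Y: "smooth_field A Y" and fg: "smooth_near A x f" "smooth_near A x g"
    for \<xi> and Y :: "'a vfield" and f g
  proof -
    have Y': "Y y \<in> tangent A y" for y using Y by (simp add: smooth_field_def)
    have ev: "\<forall>\<^sub>F y in nhds x. Y y (\<lambda>z. f z * g z) = Y y f * g y + f y * Y y g"
      using fg[THEN smooth_near_eventually]
      by eventually_elim (rule tangentD(3)[OF Y'])
    note Yfg = fg[THEN smooth_field_smooth_near[OF Y]]
    have "\<xi> (\<lambda>y. Y y (\<lambda>z. f z * g z)) = \<xi> (\<lambda>y. Y y f * g y + f y * Y y g)"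
      by (rule iter[OF X, where Y = Y and f = "\<lambda>z. f z * g z", OF _ ev]) (intro smooth_near_add smooth_near_mult fg Yfg)
    also have "\<dots> = \<xi> (\<lambda>y. Y y f * g y) + \<xi> (\<lambda>y. f y * Y y g)"
      by (rule tangentD(1)[OF X]) (intro smooth_near_mult fg Yfg)+
    also have "\<dots> = \<xi> (\<lambda>y. Y y f) * g x + Y x f * \<xi> g + (\<xi> f * Y x g + f x * \<xi> (\<lambda>y. Y y g))"
      using tangentD(3)[OF X] fg Yfg by simp
    finally show ?thesis by simp
  qed
  have local: "\<xi> (\<lambda>y. Y y f) = \<xi> (\<lambda>y. Y y g)"
    if X: "\<xi> \<in> tangent A x" and Y: "smooth_field A Y" and f: "smooth_near A x f"
      and fg: "\<forall>\<^sub>F y in nhds x. f y = g y"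
    for \<xi> and Y :: "'a vfield" and f g
  proof -
    have Y': "Y y \<in> tangent A y" for y using Y by (simp add: smooth_field_def)
    have fg_ev: "\<forall>\<^sub>F y in nhds x. \<forall>\<^sub>F z in nhds y. f z = g z"
      using fg by (simp only: eventually_eventually)
    have "\<forall>\<^sub>F y in nhds x. Y y f = Y y g"
      using smooth_near_eventually[OF f] fg_ev
      by eventually_elim (rule tangentD(4)[OF Y'])
    then show ?thesis
      using tangentD(4)[OF X smooth_field_smooth_near[OF Y f], of "\<lambda>y. Y y g"] by blast
  qed
  show ?thesis
  proof (rule tangentI)
    fix f g assume fg: "smooth_near A x f" "smooth_near A x g"
    show "lie_bracket A V W x (\<lambda>y. f y + g y) = lie_bracket A V W x f + lie_bracket A V W x g"
      using fg smooth_near_add[OF fg] add[OF V' W fg] add[OF W' V fg] by (simp add: lie_bracket_def)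
    show "lie_bracket A V W x (\<lambda>y. f y * g y) = lie_bracket A V W x f * g x + f x * lie_bracket A V W x g"
      using fg smooth_near_mult[OF fg] mult[OF V' W fg] mult[OF W' V fg]
      by (simp add: lie_bracket_def algebra_simps)
  next
    fix f c assume f: "smooth_near A x f"
    show "lie_bracket A V W x (\<lambda>y. c * f y) = c * lie_bracket A V W x f"
      using f smooth_near_mult[OF smooth_near_const f] scale[OF V' W f] scale[OF W' V f]
      by (simp add: lie_bracket_def algebra_simps)
  next
    fix f g assume fg: "smooth_near A x f" "\<forall>\<^sub>F y in nhds x. f y = g y"
    show "lie_bracket A V W x f = lie_bracket A V W x g"
      using fg smooth_near_cong[OF A fg] local[OF V' W fg] local[OF W' V fg] by (simp add: lie_bracket_def)
  qed (simp add: lie_bracket_def)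
qed

section \<open>Splitting of tangent vectors into types\<close>

definition chart_deriv ::
    "('x::topological_space, 'n::finite) atlas \<Rightarrow> 'x set \<Rightarrow> ('x \<Rightarrow> complex ^ 'n) \<Rightarrow> 'x
      \<Rightarrow> complex ^ 'n \<Rightarrow> 'x tvec" where
  "chart_deriv A U \<phi> x v = (\<lambda>f.
     if smooth_near A x f then frechet_derivative (\<lambda>z. f (inv_into U \<phi> z)) (at (\<phi> x)) v else 0)"

context
  fixes A :: "('x::{t2_space, second_countable_topology}, 'n::finite) atlas"
    and U :: "'x set" and \<phi> :: "'x \<Rightarrow> complex ^ 'n" and x :: 'x
  assumes A: "complex_manifold A" and chart: "(U, \<phi>) \<in> A" and x: "x \<in> U"
begin

lemma smooth_near_has_derivative:
  assumes "smooth_near A x f"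
  shows "((\<lambda>z. f (inv_into U \<phi> z)) has_derivative (\<lambda>v. chart_deriv A U \<phi> x v f)) (at (\<phi> x))"
proof -
  obtain W where W: "x \<in> W" "smooth_fun_on A W f"
    using assms unfolding smooth_near_def by blast
  then have "Csmooth (\<phi> ` (W \<inter> U)) (\<lambda>z. f (inv_into U \<phi> z))"
    using chart unfolding smooth_fun_on_def by blast
  then show ?thesis
    using Csmooth_has_derivative[of "\<phi> ` (W \<inter> U)" _ "\<phi> x"] W x assms
    by (simp add: chart_deriv_def)
qed

lemma chart_deriv_eqI:
  assumes "smooth_near A x f" "((\<lambda>z. f (inv_into U \<phi> z)) has_derivative L) (at (\<phi> x))"
  shows "chart_deriv A U \<phi> x v f = L v"
  using has_derivative_unique[OF smooth_near_has_derivative[OF assms(1)] assms(2)] by metis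

lemma chart_deriv_in_tangent: "chart_deriv A U \<phi> x v \<in> tangent A x"
proof (rule tangentI)
  fix f g assume fg: "smooth_near A x f" "smooth_near A x g"
  note d = fg[THEN smooth_near_has_derivative]
  show "chart_deriv A U \<phi> x v (\<lambda>y. f y + g y) = chart_deriv A U \<phi> x v f + chart_deriv A U \<phi> x v g"
    by (rule chart_deriv_eqI[OF smooth_near_add[OF fg] has_derivative_add[OF d]])
  show "chart_deriv A U \<phi> x v (\<lambda>y. f y * g y) =
      chart_deriv A U \<phi> x v f * g x + f x * chart_deriv A U \<phi> x v g"
    using chart_deriv_eqI[OF smooth_near_mult[OF fg] has_derivative_mult[OF d]]
    by (simp add: chartD(5)[OF A chart x])
next
  fix c f assume f: "smooth_near A x f"
  show "chart_deriv A U \<phi> x v (\<lambda>y. c * f y) = c * chart_deriv A U \<phi> x v f"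
    by (rule chart_deriv_eqI[OF smooth_near_mult[OF smooth_near_const f]
          has_derivative_mult_right[OF smooth_near_has_derivative[OF f]]])
next
  fix f g assume fg: "smooth_near A x f" "\<forall>\<^sub>F y in nhds x. f y = g y"
  obtain W where W: "open W" "x \<in> W" "\<And>y. y \<in> W \<Longrightarrow> f y = g y"
    using fg(2) unfolding eventually_nhds by blast
  have "((\<lambda>z. g (inv_into U \<phi> z)) has_derivative (\<lambda>v. chart_deriv A U \<phi> x v f)) (at (\<phi> x))"
    by (rule has_derivative_transform_within_open[OF smooth_near_has_derivative[OF fg(1)]
          open_chart_image[OF A chart W(1)]])
      (use W x chartD(5)[OF A chart] in auto)
  then show "chart_deriv A U \<phi> x v f = chart_deriv A U \<phi> x v g"
    using chart_deriv_eqI[OF smooth_near_cong[OF A fg]] by metis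
qed (simp add: chart_deriv_def)

lemma hol_near_has_derivative:
  assumes "hol_near A x f"
  obtains L where "((\<lambda>z. f (inv_into U \<phi> z)) has_derivative L) (at (\<phi> x))"
    "\<forall>c v. L (c *s v) = c * L v"
proof -
  obtain W where W: "x \<in> W" "hol_fun_on A W f"
    using assms unfolding hol_near_def by blast
  then have "mholomorphic_on (\<phi> ` (W \<inter> U)) (\<lambda>z. f (inv_into U \<phi> z))"
    using chart unfolding hol_fun_on_def by blast
  moreover have "\<phi> x \<in> \<phi> ` (W \<inter> U)" using W x by blast
  ultimately show ?thesis unfolding mholomorphic_on_def using that by blast
qed

text \<open>The two projections of a real direction \<open>v\<close>: multiplication of \<open>v\<close> by \<open>\<i>\<close> is the complex
  structure \<open>J\<close>, and these are \<open>(v - \<i> J v) / 2\<close> and \<open>(v + \<i> J v) / 2\<close> in the complexified tangent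
  space. For the coordinate direction \<open>v = axis j 1\<close> they are \<open>\<partial>/\<partial>z\<^sub>j\<close> and its conjugate.\<close>

definition chart_deriv10 :: "complex ^ 'n \<Rightarrow> 'x tvec" where
  "chart_deriv10 v = (\<lambda>f. (chart_deriv A U \<phi> x v f - \<i> * chart_deriv A U \<phi> x (\<i> *s v) f) / 2)"

definition chart_deriv01 :: "complex ^ 'n \<Rightarrow> 'x tvec" where
  "chart_deriv01 v = (\<lambda>f. (chart_deriv A U \<phi> x v f + \<i> * chart_deriv A U \<phi> x (\<i> *s v) f) / 2)"

lemma chart_deriv_lincomb: "(\<lambda>f. a * chart_deriv A U \<phi> x v f + b * chart_deriv A U \<phi> x w f) \<in> tangent A x"
  using tangent_lincomb[of "{True, False}" "\<lambda>i. chart_deriv A U \<phi> x (if i then v else w)" A x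
      "\<lambda>i. if i then a else b"] chart_deriv_in_tangent
  by simp

lemma chart_deriv10_in_tangent10: "chart_deriv10 v \<in> tangent10 A x"
proof -
  have "chart_deriv10 v \<in> tangent A x"
    using chart_deriv_lincomb[of "1 / 2" v "- \<i> / 2" "\<i> *s v"]
    by (simp add: chart_deriv10_def diff_divide_distrib)
  moreover have "chart_deriv10 v (\<lambda>y. cnj (f y)) = 0" if f: "hol_near A x f" for f
  proof (cases "smooth_near A x (\<lambda>y. cnj (f y))")
    case True
    obtain L where L: "((\<lambda>z. f (inv_into U \<phi> z)) has_derivative L) (at (\<phi> x))"
      "\<forall>c v. L (c *s v) = c * L v"
      using hol_near_has_derivative[OF f] .
    have "chart_deriv A U \<phi> x w (\<lambda>y. cnj (f y)) = cnj (L w)" for w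
      by (rule chart_deriv_eqI[OF True]) (rule has_derivative_cnj[OF L(1)])
    then show ?thesis by (simp add: chart_deriv10_def L(2))
  qed (simp add: chart_deriv10_def chart_deriv_def)
  ultimately show ?thesis by (simp add: tangent10_def)
qed

lemma chart_deriv01_in_tangent01: "chart_deriv01 v \<in> tangent01 A x"
proof -
  have "chart_deriv01 v \<in> tangent A x"
    using chart_deriv_lincomb[of "1 / 2" v "\<i> / 2" "\<i> *s v"]
    by (simp add: chart_deriv01_def add_divide_distrib)
  moreover have "chart_deriv01 v f = 0" if f: "hol_near A x f" for f
  proof (cases "smooth_near A x f")
    case True
    obtain L where L: "((\<lambda>z. f (inv_into U \<phi> z)) has_derivative L) (at (\<phi> x))"
      "\<forall>c v. L (c *s v) = c * L v"
      using hol_near_has_derivative[OF f] .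
    have "chart_deriv A U \<phi> x w f = L w" for w
      by (rule chart_deriv_eqI[OF True L(1)])
    then show ?thesis by (simp add: chart_deriv01_def L(2))
  qed (simp add: chart_deriv01_def chart_deriv_def)
  ultimately show ?thesis by (simp add: tangent01_def)
qed

text \<open>The tangent space, defined abstractly by derivations, is spanned by the coordinate derivatives:
  applying \<open>\<xi>\<close> to Hadamard's expansion of \<open>f\<close> at \<open>x\<close>, the constant is annihilated, and in each
  product the factor \<open>(\<phi> y - \<phi> x) \<bullet> i\<close> vanishes at \<open>x\<close>, so that only its derivative along \<open>\<xi>\<close>
  survives.\<close>

lemma tangent_eq_sum_chart_deriv:
  assumes \<xi>: "\<xi> \<in> tangent A x" and f: "smooth_near A x f"
  shows "\<xi> f = (\<Sum>i\<in>Basis. \<xi> (\<lambda>y. of_real ((\<phi> y - \<phi> x) \<bullet> i)) * chart_deriv A U \<phi> x i f)"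
proof -
  define X where "X = (\<lambda>i y. complex_of_real ((\<phi> y - \<phi> x) \<bullet> i))"
  obtain W where W: "open W" "x \<in> W" "smooth_fun_on A W f"
    using f unfolding smooth_near_def by blast
  have F: "Csmooth (\<phi> ` (W \<inter> U)) (\<lambda>z. f (inv_into U \<phi> z))"
    using chart W(3) unfolding smooth_fun_on_def by blast
  have "\<phi> x \<in> \<phi> ` (W \<inter> U)" using W x by blast
  then obtain r where r: "r > 0" "ball (\<phi> x) r \<subseteq> \<phi> ` (W \<inter> U)"
    using open_chart_image[OF A chart W(1)] open_contains_ball by blast
  have "Csmooth (ball (\<phi> x) r) (\<lambda>z. f (inv_into U \<phi> z))"
    using F r(2) unfolding Csmooth_def by (blast intro: Ck_subset)
  then obtain g where g: "\<And>i. Csmooth (ball (\<phi> x) r) (g i)"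
    "\<And>z. z \<in> ball (\<phi> x) r \<Longrightarrow> f (inv_into U \<phi> z) =
       f (inv_into U \<phi> (\<phi> x)) + (\<Sum>i\<in>Basis. of_real ((z - \<phi> x) \<bullet> i) * g i z)"
    "\<And>i. g i (\<phi> x) = frechet_derivative (\<lambda>z. f (inv_into U \<phi> z)) (at (\<phi> x)) i"
    using Hadamard[OF _ r(1)] by blast
  define W' where "W' = U \<inter> \<phi> -` ball (\<phi> x) r"
  have W': "open W'" "x \<in> W'" "W' \<subseteq> U" "\<phi> ` W' \<subseteq> ball (\<phi> x) r"
    using continuous_open_preimage[OF chartD(4,1)[OF A chart] open_ball] x r(1)
    by (auto simp: W'_def)
  have "smooth_fun_on A W' (\<lambda>y. g i (\<phi> y))" for i
    by (rule smooth_fun_on_chartI[OF A chart W'(1,3)])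
      (use g(1) W'(4) in \<open>auto simp: Csmooth_def intro: Ck_subset\<close>)
  then have G: "smooth_near A x (\<lambda>y. g i (\<phi> y))" for i
    using smooth_nearI W'(1,2) by blast
  have "smooth_fun_on A U (X i)" for i
    unfolding X_def
  proof (rule smooth_fun_on_chartI[OF A chart chartD(1)[OF A chart] order_refl])
    have "bounded_linear (\<lambda>z. complex_of_real (z \<bullet> i))"
      by (intro bounded_linear_compose[OF bounded_linear_of_real] bounded_linear_inner_left)
    then have "Csmooth (\<phi> ` U) (\<lambda>z. complex_of_real (z \<bullet> i) + (- complex_of_real (\<phi> x \<bullet> i)))"
      unfolding Csmooth_def by (intro allI Ck_add Ck_const Ck_linear)
    then show "Csmooth (\<phi> ` U) (\<lambda>z. complex_of_real ((z - \<phi> x) \<bullet> i))"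
      by (simp add: inner_diff_left)
  qed
  then have X: "smooth_near A x (X i)" for i
    using smooth_nearI[OF chartD(1)[OF A chart] x] by blast
  have "\<forall>\<^sub>F y in nhds x. f y = f x + (\<Sum>i\<in>Basis. X i y * g i (\<phi> y))"
    unfolding eventually_nhds
  proof (intro exI[of _ W'] conjI ballI)
    fix y assume y: "y \<in> W'"
    then have "\<phi> y \<in> ball (\<phi> x) r" "y \<in> U" using W' by auto
    from g(2)[OF this(1)] show "f y = f x + (\<Sum>i\<in>Basis. X i y * g i (\<phi> y))"
      by (simp add: chartD(5)[OF A chart] x \<open>y \<in> U\<close> X_def)
  qed (use W' in auto)
  then have "\<xi> f = \<xi> (\<lambda>y. f x + (\<Sum>i\<in>Basis. X i y * g i (\<phi> y)))"
    by (rule tangentD(4)[OF \<xi> f])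
  also have "\<dots> = \<xi> (\<lambda>y. \<Sum>i\<in>Basis. X i y * g i (\<phi> y))"
  proof -
    have "smooth_near A x (\<lambda>y. \<Sum>i\<in>Basis. X i y * g i (\<phi> y))"
      by (intro smooth_near_sum smooth_near_mult X G)
    from tangentD(1)[OF \<xi> smooth_near_const this, of "f x"] show ?thesis
      by (simp add: tangent_const[OF \<xi>])
  qed
  also have "\<dots> = (\<Sum>i\<in>Basis. \<xi> (\<lambda>y. X i y * g i (\<phi> y)))"
    by (rule tangent_apply_sum[OF \<xi>]) (rule smooth_near_mult[OF X G])
  also have "\<dots> = (\<Sum>i\<in>Basis. \<xi> (X i) * chart_deriv A U \<phi> x i f)"
  proof -
    have "X i x = 0" for i by (simp add: X_def)
    then show ?thesis
      using f by (simp add: tangentD(3)[OF \<xi> X G] g(3) chart_deriv_def)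
  qed
  finally show ?thesis by (simp add: X_def)
qed

lemma tangent_decompose_chart:
  assumes \<xi>: "\<xi> \<in> tangent A x"
  shows "\<exists>\<eta>\<in>tangent10 A x. \<exists>\<zeta>\<in>tangent01 A x. \<xi> = (\<lambda>f. \<eta> f + \<zeta> f)"
proof -
  define a where "a i = \<xi> (\<lambda>y. of_real ((\<phi> y - \<phi> x) \<bullet> i))" for i
  have *: "\<xi> f = (\<Sum>i\<in>Basis. a i * chart_deriv10 i f) + (\<Sum>i\<in>Basis. a i * chart_deriv01 i f)" for f
  proof (cases "smooth_near A x f")
    case True
    show ?thesis
      unfolding tangent_eq_sum_chart_deriv[OF \<xi> True] sum.distrib[symmetric] a_def[symmetric]
      by (rule sum.cong) (simp_all add: chart_deriv10_def chart_deriv01_def field_simps)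
  qed (simp add: chart_deriv10_def chart_deriv01_def chart_deriv_def tangentD(5)[OF \<xi>])
  show ?thesis
  proof (intro bexI)
    show "\<xi> = (\<lambda>f. (\<Sum>i\<in>Basis. a i * chart_deriv10 i f) + (\<Sum>i\<in>Basis. a i * chart_deriv01 i f))"
      using * by blast
  qed (auto intro!: tangent10_lincomb tangent01_lincomb chart_deriv10_in_tangent10 chart_deriv01_in_tangent01)
qed

end

lemma tangent_decompose:
  fixes A :: "('x::{t2_space, second_countable_topology}, 'n::finite) atlas"
  assumes "complex_manifold A" "\<xi> \<in> tangent A x"
  obtains \<eta> \<zeta> where "\<eta> \<in> tangent10 A x" "\<zeta> \<in> tangent01 A x" "\<xi> = (\<lambda>f. \<eta> f + \<zeta> f)"
proof -
  obtain U \<phi> where "(U, \<phi>) \<in> A" "x \<in> U" using obtain_chart[OF assms(1)] .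
  from tangent_decompose_chart[OF assms(1) this assms(2)] show ?thesis by (elim bexE that)
qed

section \<open>Chern connections\<close>

lemma holomorphic_vector_bundleD:
  assumes "holomorphic_vector_bundle A B"
  shows "vector_space (smul B)" "module.subspace (smul B) (fibre B x)"
    "(\<Union>(U, r, e)\<in>frames B. U) = UNIV"
proof -
  note * = assms[unfolded holomorphic_vector_bundle_def]
  show "vector_space (smul B)" by (rule *[THEN conjunct1])
  show "module.subspace (smul B) (fibre B x)" by (rule *[THEN conjunct2, THEN conjunct1, THEN spec])
  show "(\<Union>(U, r, e)\<in>frames B. U) = UNIV"
    by (rule *[THEN conjunct2, THEN conjunct2, THEN conjunct1])
qed

lemma smooth_hermitian_formD:
  assumes "smooth_hermitian_form A B b" "u \<in> fibre B x" "v \<in> fibre B x" "w \<in> fibre B x"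
  shows "b x (u + v) w = b x u w + b x v w" "b x (smul B c v) w = c * b x v w"
    "b x w v = cnj (b x v w)"
  using assms(1)[unfolded smooth_hermitian_form_def, THEN conjunct1, THEN spec, THEN bspec,
      OF assms(2), THEN bspec, OF assms(3), THEN bspec, OF assms(4), THEN spec, of c]
  by simp_all

lemma hermitian_form_diff:
  assumes "holomorphic_vector_bundle A B" "smooth_hermitian_form A B b"
    and "u \<in> fibre B x" "v \<in> fibre B x" "w \<in> fibre B x"
  shows "b x (u - v) w = b x u w - b x v w"
proof -
  interpret vector_space "smul B" by (rule holomorphic_vector_bundleD(1)[OF assms(1)])
  from holomorphic_vector_bundleD(2)[OF assms(1)] have "u - v \<in> fibre B x" using assms(3,4) by (rule subspace_diff)
  then have "b x ((u - v) + v) w = b x (u - v) w + b x v w"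
    using assms(4,5) by (rule smooth_hermitian_formD(1)[OF assms(2)])
  then show ?thesis by simp
qed

lemma chern_connectionD:
  assumes "chern_connection A B b D" "smooth_section A B s"
  shows "\<xi> \<in> tangent A x \<Longrightarrow> D s x \<xi> \<in> fibre B x"
    and "\<xi> \<in> tangent A x \<Longrightarrow> \<eta> \<in> tangent A x \<Longrightarrow> D s x (\<lambda>f. \<xi> f + \<eta> f) = D s x \<xi> + D s x \<eta>"
    and "smooth_field A V \<Longrightarrow> smooth_section A B (\<lambda>x. D s x (V x))"
    and "smooth_section A B t \<Longrightarrow> \<xi> \<in> tangent A x \<Longrightarrow>
      \<xi> (\<lambda>y. b y (s y) (t y)) = b x (D s x \<xi>) (t x) + b x (s x) (D t x (cnj_tvec \<xi>))"
    and "has_01_part_dbar A B (D s) s"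
proof -
  note * = assms(1)[unfolded chern_connection_def]
  have form: "smooth_vform1 A B (D s)"
    using *[THEN conjunct1, unfolded is_connection_def, THEN conjunct1] assms(2) by blast
  show "\<xi> \<in> tangent A x \<Longrightarrow> D s x \<xi> \<in> fibre B x"
    using form[unfolded smooth_vform1_def, THEN conjunct1] by blast
  show "\<xi> \<in> tangent A x \<Longrightarrow> \<eta> \<in> tangent A x \<Longrightarrow>
      D s x (\<lambda>f. \<xi> f + \<eta> f) = D s x \<xi> + D s x \<eta>"
    using form[unfolded smooth_vform1_def, THEN conjunct2, THEN conjunct1] by blast
  show "smooth_field A V \<Longrightarrow> smooth_section A B (\<lambda>x. D s x (V x))"
    using form[unfolded smooth_vform1_def, THEN conjunct2, THEN conjunct2, THEN conjunct2] by blast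
  show "smooth_section A B t \<Longrightarrow> \<xi> \<in> tangent A x \<Longrightarrow>
      \<xi> (\<lambda>y. b y (s y) (t y)) = b x (D s x \<xi>) (t x) + b x (s x) (D t x (cnj_tvec \<xi>))"
    using *[THEN conjunct2, THEN conjunct1] assms(2) by blast
  show "has_01_part_dbar A B (D s) s"
    using *[THEN conjunct2, THEN conjunct2] assms(2) by blast
qed

text \<open>In a holomorphic frame both values are the Dolbeault derivative of the same coefficients of
  \<open>s\<close>.\<close>

lemma chern_connection_eq_on_tangent01:
  assumes B: "holomorphic_vector_bundle A B"
    and D: "chern_connection A B b D" and D': "chern_connection A B b D'"
    and s: "smooth_section A B s" and \<xi>: "\<xi> \<in> tangent01 A x"
  shows "D s x \<xi> = D' s x \<xi>"
proof -
  have "x \<in> (\<Union>(U, r, e)\<in>frames B. U)"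
    unfolding holomorphic_vector_bundleD(3)[OF B] by simp
  then obtain U r e where U: "(U, r, e) \<in> frames B" "x \<in> U" by auto
  then obtain f where f: "\<forall>j<r. smooth_fun_on A U (f j)"
      "\<forall>x\<in>U. s x = (\<Sum>j<r. smul B (f j x) (e j x))"
    using s unfolding smooth_section_def by blast
  have "E s x \<xi> = (\<Sum>j<r. smul B (\<xi> (f j)) (e j x))" if "chern_connection A B b E" for E
    using chern_connectionD(5)[OF that s] U f \<xi> unfolding has_01_part_dbar_def by blast
  with D D' show ?thesis by metis
qed

text \<open>Although \<open>D s\<close> itself need not be determined when \<open>b\<close> is degenerate, its pairing with any smooth
  section is. In a direction \<open>\<zeta>\<close> of type \<open>(0,1)\<close> this is clear. In a direction \<open>\<eta>\<close> of type \<open>(1,0)\<close> the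
  metric condition expresses \<open>b (D\<^sub>\<eta> s, t)\<close> through \<open>\<eta> (b (s, t))\<close> and the derivative of \<open>t\<close> in the
  conjugate direction, which is of type \<open>(0,1)\<close>. A general direction is a sum of the two.\<close>

lemma chern_connection_pairing_eq:
  fixes A :: "('x::{t2_space, second_countable_topology}, 'n::finite) atlas"
  assumes A: "complex_manifold A" and B: "holomorphic_vector_bundle A B"
    and b: "smooth_hermitian_form A B b"
    and D: "chern_connection A B b D" and D': "chern_connection A B b D'"
    and s: "smooth_section A B s" and t: "smooth_section A B t"
    and \<xi>: "\<xi> \<in> tangent A x"
  shows "b x (D s x \<xi>) (t x) = b x (D' s x \<xi>) (t x)"
proof -
  obtain \<eta> \<zeta> where \<eta>\<zeta>: "\<eta> \<in> tangent10 A x" "\<zeta> \<in> tangent01 A x" "\<xi> = (\<lambda>f. \<eta> f + \<zeta> f)"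
    using tangent_decompose[OF A \<xi>] .
  then have tan: "\<eta> \<in> tangent A x" "\<zeta> \<in> tangent A x"
    by (auto simp: tangent10_def tangent01_def)
  have tx: "t x \<in> fibre B x" using t by (simp add: smooth_section_def)
  have split: "b x (E s x \<xi>) (t x) =
      \<eta> (\<lambda>y. b y (s y) (t y)) - b x (s x) (E t x (cnj_tvec \<eta>)) + b x (E s x \<zeta>) (t x)"
    if E: "chern_connection A B b E" for E
  proof -
    have "E s x \<xi> = E s x \<eta> + E s x \<zeta>"
      unfolding \<eta>\<zeta>(3) by (rule chern_connectionD(2)[OF E s tan])
    then have "b x (E s x \<xi>) (t x) = b x (E s x \<eta>) (t x) + b x (E s x \<zeta>) (t x)"
      by (simp add: smooth_hermitian_formD(1)[OF b tan[THEN chern_connectionD(1)[OF E s]] tx])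
    then show ?thesis
      using chern_connectionD(4)[OF E s t tan(1)] by simp
  qed
  have "D t x (cnj_tvec \<eta>) = D' t x (cnj_tvec \<eta>)"
    by (rule chern_connection_eq_on_tangent01[OF B D D' t cnj_tvec_tangent10[OF \<eta>\<zeta>(1)]])
  moreover have "D s x \<zeta> = D' s x \<zeta>"
    by (rule chern_connection_eq_on_tangent01[OF B D D' s \<eta>\<zeta>(2)])
  ultimately show ?thesis
    using split[OF D] split[OF D'] by simp
qed

theorem theorem2p4:
  fixes A :: "('x::{t2_space, second_countable_topology}, 'n::finite) atlas"
    and B :: "('x, 'v::ab_group_add) vbundle"
    and b :: "'x \<Rightarrow> 'v \<Rightarrow> 'v \<Rightarrow> complex"
    and D D' :: "('x \<Rightarrow> 'v) \<Rightarrow> ('x, 'v) vform1"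
    and \<alpha> \<beta> :: "'x vfield"
    and s t :: "'x \<Rightarrow> 'v"
  assumes "complex_manifold A"
    and "holomorphic_vector_bundle A B"
    and "smooth_hermitian_form A B b"
    and "chern_connection A B b D"
    and "chern_connection A B b D'"
    and "smooth_field10 A \<alpha>" and "smooth_field10 A \<beta>"
    and "smooth_section A B s" and "smooth_section A B t"
  shows "curvature_tensor A B b D \<alpha> \<beta> s t = curvature_tensor A B b D' \<alpha> \<beta> s t"
proof
  fix x
  note A = assms(1) and B = assms(2) and b = assms(3) and D = assms(4) and D' = assms(5)
    and s = assms(8) and t = assms(9)
  define W where "W = cnj_field \<beta>"
  have \<alpha>: "smooth_field A \<alpha>" "\<And>y. \<alpha> y \<in> tangent A y"
    using assms(6) by (auto simp: smooth_field10_def smooth_field_def)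
  have \<beta>: "smooth_field A \<beta>" "\<And>y. \<beta> y \<in> tangent A y"
    using assms(7) by (auto simp: smooth_field10_def smooth_field_def)
  have W: "smooth_field A W" "\<And>y. W y \<in> tangent A y"
    using smooth_field_cnj_field[OF \<beta>(1)] by (auto simp: W_def smooth_field_def)
  have W01: "W y \<in> tangent01 A y" for y
    using assms(7) cnj_tvec_tangent10 by (auto simp: smooth_field10_def W_def cnj_field_def)
  have cnjW: "cnj_tvec (W y) = \<beta> y" for y by (simp add: W_def cnj_field_def)
  have bracket: "lie_bracket A \<alpha> W x \<in> tangent A x"
    by (rule lie_bracket_in_tangent[OF A \<alpha>(1) W(1)])
  have tx: "t x \<in> fibre B x" using t by (simp add: smooth_section_def)
  note pair = chern_connection_pairing_eq[OF A B b D D']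
  have u: "(\<lambda>y. D s y (W y)) = (\<lambda>y. D' s y (W y))"
    using chern_connection_eq_on_tangent01[OF B D D' s W01] by blast
  have tensor: "curvature_tensor A B b E \<alpha> \<beta> s t x = \<i> / 2 *
      (b x (E (\<lambda>y. E s y (W y)) x (\<alpha> x)) (t x)
       - (W x (\<lambda>y. b y (E s y (\<alpha> y)) (t y)) - b x (E s x (\<alpha> x)) (E t x (\<beta> x)))
       - b x (E s x (lie_bracket A \<alpha> W x)) (t x))"
    if E: "chern_connection A B b E" for E
  proof -
    interpret vector_space "smul B" by (rule holomorphic_vector_bundleD(1)[OF B])
    note sub = holomorphic_vector_bundleD(2)[OF B, of x]
    define P Q S where "P = E (\<lambda>y. E s y (W y)) x (\<alpha> x)"
      and "Q = E (\<lambda>y. E s y (\<alpha> y)) x (W x)" and "S = E s x (lie_bracket A \<alpha> W x)"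
    note sect = chern_connectionD(3)[OF E s \<alpha>(1)] chern_connectionD(3)[OF E s W(1)]
    have fib: "P \<in> fibre B x" "Q \<in> fibre B x" "S \<in> fibre B x"
      unfolding P_def Q_def S_def
      by (rule chern_connectionD(1)[OF E] sect s \<alpha> W bracket)+
    have PQ: "P - Q \<in> fibre B x" using sub fib(1,2) by (rule subspace_diff)
    have PQS: "P - Q - S \<in> fibre B x" using sub PQ fib(3) by (rule subspace_diff)
    have "curvature_tensor A B b E \<alpha> \<beta> s t x = b x (smul B (\<i> / 2) (P - Q - S)) (t x)"
      by (simp add: curvature_tensor_def curvature_form_def ext_cov_deriv_def P_def Q_def S_def W_def)
    also have "\<dots> = \<i> / 2 * b x (P - Q - S) (t x)"
      by (rule smooth_hermitian_formD(2)[OF b PQS PQS tx])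
    also have "\<dots> = \<i> / 2 * (b x P (t x) - b x Q (t x) - b x S (t x))"
      by (simp only: hermitian_form_diff[OF B b _ _ tx] PQ fib)
    also have "b x Q (t x) = W x (\<lambda>y. b y (E s y (\<alpha> y)) (t y)) - b x (E s x (\<alpha> x)) (E t x (\<beta> x))"
      using chern_connectionD(4)[OF E sect(1) t W(2)] by (simp add: Q_def cnjW)
    finally show ?thesis by (simp only: P_def S_def)
  qed
  have "b x (D (\<lambda>y. D s y (W y)) x (\<alpha> x)) (t x) = b x (D' (\<lambda>y. D' s y (W y)) x (\<alpha> x)) (t x)"
    unfolding u[symmetric] by (rule pair[OF chern_connectionD(3)[OF D s W(1)] t \<alpha>(2)])
  moreover have "(\<lambda>y. b y (D s y (\<alpha> y)) (t y)) = (\<lambda>y. b y (D' s y (\<alpha> y)) (t y))"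
    using pair[OF s t \<alpha>(2)] by blast
  \<comment> \<open>Both arguments depend on the connection. They are exchanged one at a time: first the left
      one, then the right one, which Hermitian symmetry brings into first position.\<close>
  moreover have "b x (D s x (\<alpha> x)) (D t x (\<beta> x)) = b x (D' s x (\<alpha> x)) (D' t x (\<beta> x))"
  proof -
    have herm: "b x v w = cnj (b x w v)" if "v \<in> fibre B x" "w \<in> fibre B x" for v w
      by (rule smooth_hermitian_formD(3)[OF b that(2,2,1)])
    note fib\<alpha> = chern_connectionD(1)[OF D' s \<alpha>(2)[of x]]
    note fib\<beta> = chern_connectionD(1)[OF D t \<beta>(2)[of x]] chern_connectionD(1)[OF D' t \<beta>(2)[of x]]
    have "b x (D s x (\<alpha> x)) (D t x (\<beta> x)) = b x (D' s x (\<alpha> x)) (D t x (\<beta> x))"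
      by (rule pair[OF s chern_connectionD(3)[OF D t \<beta>(1)] \<alpha>(2)])
    also have "\<dots> = cnj (b x (D t x (\<beta> x)) (D' s x (\<alpha> x)))"
      by (rule herm[OF fib\<alpha> fib\<beta>(1)])
    also have "b x (D t x (\<beta> x)) (D' s x (\<alpha> x)) = b x (D' t x (\<beta> x)) (D' s x (\<alpha> x))"
      by (rule pair[OF t chern_connectionD(3)[OF D' s \<alpha>(1)] \<beta>(2)])
    also have "cnj \<dots> = b x (D' s x (\<alpha> x)) (D' t x (\<beta> x))"
      by (rule herm[OF fib\<alpha> fib\<beta>(2), symmetric])
    finally show ?thesis .
  qed
  moreover have "b x (D s x (lie_bracket A \<alpha> W x)) (t x) = b x (D' s x (lie_bracket A \<alpha> W x)) (t x)"
    by (rule pair[OF s t bracket])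
  ultimately show "curvature_tensor A B b D \<alpha> \<beta> s t x = curvature_tensor A B b D' \<alpha> \<beta> s t x"
    by (simp only: tensor[OF D] tensor[OF D'])
qed

end
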